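(* Let $K$ be a commutative ring with unit, $X$ a well-ordered set, $\mathrm{Lie}(X)$ the free Lie algebra over $K$ generated by $X$, and $\vartheta\subseteq (X\times X)\setminus\{(x,x)\mid x\in X\}$. With the deg-lex ordering on $X^*$, the set $$S=\{[xuy]\ \mid\ x,y\in X,\ u\in X^*,\ x\rhd y\rhd \mathrm{supp}(u)\}$$ is a Gröbner–Shirshov basis in $\mathrm{Lie}(X)$. As a result, the set $$\mathrm{Irr}(S)=\{[u]\ \mid\ [u]\text{ is a NLSW},\ u\neq a\overline{s}b \text{ for all } s\in S,\ a,b\in X^*\}$$ is a $K$-basis of the free partially commutative Lie algebra $\mathrm{Lie}(X\mid\vartheta)=\mathrm{Lie}(X\mid S)$ (that is, the images of the elements of $\mathrm{Irr}(S)$ form a $K$-basis of this quotient algebra).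
   Context: Setting. $K$ is a commutative ring with unit $1\neq 0$; $X$ is a set with a well ordering $<$; $X^*$ is the free monoid on $X$ (including the empty word $1$). The Lie product is written $(ab)$. $\mathrm{Lie}(X)$ is identified with the Lie subalgebra generated by $X$ of the free associative algebra $K\langle X\rangle$, with $(ab)=ab-ba$. For $T\subseteq \mathrm{Lie}(X)$, $\mathrm{Id}(T)$ is the ideal of $\mathrm{Lie}(X)$ generated by $T$, and $\mathrm{Lie}(X\mid T)=\mathrm{Lie}(X)/\mathrm{Id}(T)$. For $\vartheta$ as in the claim, the free partially commutative Lie algebra is $\mathrm{Lie}(X\mid\vartheta)=\mathrm{Lie}(X)/\mathrm{Id}(\{(ab)\mid (a,b)\in\vartheta\})$. Relation $\rhd$. For $a,b\in X$, $a\rhd b$ means $a>b$ and ($(a,b)\in\vartheta$ or $(b,a)\in\vartheta$). For $Y\subseteq X$, $a\rhd Y$ means $a\rhd y$ for all $y\in Y$. For $u=x_{i_1}\cdots x_{i_n}\in X^*$, $\mathrm{supp}(u)=\{x_{i_1},\dots,x_{i_n}\}$ (empty if $u=1$). Thus $x\rhd y\rhd \mathrm{supp}(u)$ means $x\rhd y$ and $y\rhd\mathrm{supp}(u)$. Lyndon–Shirshov words. A word $u\in X^*$, $u\ne1$, is an ALSW (associative Lyndon–Shirshov word) if for all $v,w\in X^*\setminus\{1\}$ with $u=vw$ one has $vw>wv$ lexicographically. Each ALSW $u$ has the bracketing $[u]$ defined by $[x]=x$ for $x\in X$ and, if $|u|\ge 2$, $[u]=([v][w])$, where $u=vw$ and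 $w$ is the longest proper suffix of $u$ that is an ALSW (then $v$ is also an ALSW). The NLSW's (non-associative Lyndon–Shirshov words) are exactly the $[u]$, $u$ an ALSW; $[u]$ is also regarded as an element of $\mathrm{Lie}(X)\subset K\langle X\rangle$. Orderings and leading words. In the deg-lex ordering, words are compared first by length, then lexicographically. For nonzero $f\in K\langle X\rangle$, $\overline f$ is the largest word occurring in $f$ with nonzero coefficient with respect to deg-lex; $f$ is monic if the coefficient of $\overline f$ is $1$. $\deg(f)$ is the length of $\overline f$. For every ALSW $u$, $[u]$ is monic with $\overline{[u]}=u$. Every word can be written uniquely as $c=c_1\cdots c_k$ with each $c_j$ an ALSW and $c_1\le\cdots\le c_k$ in the lexicographic order (with the convention that a proper prefix of a word is larger than the word). Special bracketing. If $u=avb$ with $u,v$ ALSW's, $a,b\in X^*$, then $b=cd$ for some $c,d\in X^*$ such that $vc$ is an ALSW and $[u]=[a[vc]d]$, i.e. $[vc]$ is the sub-bracket of $[u]$ on this occurrence of $vc$. With $c=c_1\cdots c_k$, $c_j$ ALSW's, $c_1\le\cdots\le c_k$, let $[u]_v$ be obtained from $[u]$ by replacing this $[vc]$ by $((\cdots(([v][c_1])[c_2])\cdots)[c_k])$. If $s\in\mathrm{Lie}(X)$ is monic and $a\overline sb$ is an ALSW, then $[asb]_{\overline s}$ is obtained from $[a\overline sb]_{\overline s}$ by replacing $[\overline s]$ by $s$. Compositions. Let $f,g\in\mathrm{Lie}(X)$ be monic. (i) If $w=\overline f=a\overline gb$ with $a,b\in X^*$, the composition of inclusion is $(f,g)_w=f-[agb]_{\overline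 g}$. (ii) If $w=\overline fb=a\overline g$ with $a,b\in X^*$ and $\deg(f)+\deg(g)>|w|$, the composition of intersection is $(f,g)_w=[fb]_{\overline f}-[ag]_{\overline g}$. Gröbner–Shirshov basis. Let $S\subset \mathrm{Lie}(X)$ consist of monic elements. For $s\in S$, $a,b\in X^*$, let $(asb)$ denote some bracketing (as Lie products) of the sequence of the letters of $a$, then $s$, then the letters of $b$; it is a normal $S$-word if $a\overline sb$ is an ALSW and $\overline{(asb)}=a\overline sb$. A Lie polynomial $h$ is trivial modulo $(S,w)$ if $h=\sum_i\alpha_i(a_is_ib_i)$ (finite sum) with $\alpha_i\in K$, $a_i,b_i\in X^*$, $s_i\in S$, each $(a_is_ib_i)$ a normal $S$-word, and $a_i\overline{s_i}b_i<w$ in deg-lex. $S$ is a Gröbner–Shirshov basis in $\mathrm{Lie}(X)$ if every composition $(f,g)_w$ of elements $f,g\in S$ is trivial modulo $(S,w)$. *)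

theory Defs
  imports
    "HOL-Algebra.Module"
    "HOL-Library.Poly_Mapping"
    "HOL-Library.List_Lenlexorder"
begin

text \<open>
  Words over \<open>X\<close> are lists over a type of class \<^class>\<open>wellorder\<close>.  By List_Lenlexorder, the order
  \<open><\<close> on lists is deg-lex.  With concatenation as the (additively written) monoid operation on
  lists, the convolution product of Poly_Mapping makes \<open>'x list \<Rightarrow>\<^sub>0 'k\<close> the free associative
  algebra on \<open>'x\<close> over \<open>'k\<close>.
\<close>

instantiation list :: (type) monoid_add
begin

definition zero_list_def: "0 = []"

definition plus_list_def: "xs + ys = xs @ ys"

instance
  by standard (auto simp: zero_list_def plus_list_def)

end

type_synonym ('x, 'k) free_alg = "'x list \<Rightarrow>\<^sub>0 'k"

definition letter :: "'x \<Rightarrow> ('x, 'k::comm_ring_1) free_alg" where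
  "letter x = Poly_Mapping.single [x] 1"

definition scale :: "'k::comm_ring_1 \<Rightarrow> ('x, 'k) free_alg \<Rightarrow> ('x, 'k) free_alg" where
  "scale c f = Poly_Mapping.map ((*) c) f"

definition lie :: "('x, 'k::comm_ring_1) free_alg \<Rightarrow> ('x, 'k) free_alg \<Rightarrow> ('x, 'k) free_alg" where
  "lie f g = f * g - g * f"

inductive_set free_lie :: "('x, 'k::comm_ring_1) free_alg set" where
  letter: "letter x \<in> free_lie"
| zero: "0 \<in> free_lie"
| add: "f \<in> free_lie \<Longrightarrow> g \<in> free_lie \<Longrightarrow> f + g \<in> free_lie"
| scale: "f \<in> free_lie \<Longrightarrow> scale c f \<in> free_lie"
| lie: "f \<in> free_lie \<Longrightarrow> g \<in> free_lie \<Longrightarrow> lie f g \<in> free_lie"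

text \<open>The ideal of \<^const>\<open>free_lie\<close> generated by \<open>T\<close>; it is used for \<open>T \<subseteq> free_lie\<close> only.\<close>

inductive_set lie_ideal :: "('x, 'k::comm_ring_1) free_alg set \<Rightarrow> ('x, 'k) free_alg set"
  for T where
  gen: "f \<in> T \<Longrightarrow> f \<in> lie_ideal T"
| zero: "0 \<in> lie_ideal T"
| add: "f \<in> lie_ideal T \<Longrightarrow> g \<in> lie_ideal T \<Longrightarrow> f + g \<in> lie_ideal T"
| scale: "f \<in> lie_ideal T \<Longrightarrow> scale c f \<in> lie_ideal T"
| lie_left: "f \<in> free_lie \<Longrightarrow> g \<in> lie_ideal T \<Longrightarrow> lie f g \<in> lie_ideal T"
| lie_right: "f \<in> free_lie \<Longrightarrow> g \<in> lie_ideal T \<Longrightarrow> lie g f \<in> lie_ideal T"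

definition residue :: "('x, 'k::comm_ring_1) free_alg set \<Rightarrow> ('x, 'k) free_alg \<Rightarrow> ('x, 'k) free_alg set"
  where "residue I f = {f + h | h. h \<in> I}"

text \<open>
  \<open>Lie(X | T)\<close>, with \<open>\<otimes>\<close> as Lie product.  A Lie algebra has no unit, so the field \<open>one\<close> of the
  record is meaningless.
\<close>

definition lie_pres :: "('x, 'k::comm_ring_1) free_alg set \<Rightarrow> ('k, ('x, 'k) free_alg set) module"
  where
  "lie_pres T = (let I = lie_ideal T in
     \<lparr>carrier = residue I ` free_lie,
      mult = (\<lambda>A B. \<Union>f\<in>A. \<Union>g\<in>B. residue I (lie f g)),
      one = undefined,
      zero = residue I 0,
      add = (\<lambda>A B. \<Union>f\<in>A. \<Union>g\<in>B. residue I (f + g)),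
      smult = (\<lambda>c A. \<Union>f\<in>A. residue I (scale c f))\<rparr>)"

text \<open>The scalars form a whole type, hence the scalar field is not a locale parameter here.\<close>

definition is_basis :: "('k::comm_ring_1, 'a) module \<Rightarrow> 'a set \<Rightarrow> bool" where
  "is_basis M B \<longleftrightarrow>
     B \<subseteq> carrier M \<and>
     (\<forall>A c. finite A \<longrightarrow> A \<subseteq> B \<longrightarrow> (\<Oplus>\<^bsub>M\<^esub>b\<in>A. c b \<odot>\<^bsub>M\<^esub> b) = \<zero>\<^bsub>M\<^esub> \<longrightarrow> (\<forall>b\<in>A. c b = 0)) \<and>
     (\<forall>v\<in>carrier M. \<exists>A c. finite A \<and> A \<subseteq> B \<and> v = (\<Oplus>\<^bsub>M\<^esub>b\<in>A. c b \<odot>\<^bsub>M\<^esub> b))"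

section \<open>Lyndon--Shirshov words\<close>

text \<open>The lexicographic order in which a proper prefix of a word is larger than the word.\<close>

fun lex_less :: "'x::linorder list \<Rightarrow> 'x list \<Rightarrow> bool" where
  "lex_less [] v \<longleftrightarrow> False"
| "lex_less (a # u) [] \<longleftrightarrow> True"
| "lex_less (a # u) (b # v) \<longleftrightarrow> a < b \<or> a = b \<and> lex_less u v"

definition lex_le :: "'x::linorder list \<Rightarrow> 'x list \<Rightarrow> bool" where
  "lex_le u v \<longleftrightarrow> lex_less u v \<or> u = v"

definition alsw :: "'x::linorder list \<Rightarrow> bool" where
  "alsw u \<longleftrightarrow> u \<noteq> [] \<and>
     (\<forall>v w. v \<noteq> [] \<longrightarrow> w \<noteq> [] \<longrightarrow> u = v @ w \<longrightarrow> lex_less (w @ v) (v @ w))"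

text \<open>Non-associative words; the leaves are letters or Lie polynomials.\<close>

datatype 'a nword = Leaf 'a | Br "'a nword" "'a nword"

primrec fringe :: "'a nword \<Rightarrow> 'a list" where
  "fringe (Leaf a) = [a]"
| "fringe (Br s t) = fringe s @ fringe t"

primrec lie_eval :: "('x, 'k::comm_ring_1) free_alg nword \<Rightarrow> ('x, 'k) free_alg" where
  "lie_eval (Leaf f) = f"
| "lie_eval (Br s t) = lie (lie_eval s) (lie_eval t)"

text \<open>The position at which the longest proper suffix that is an ALSW begins.\<close>

definition cut :: "'x::linorder list \<Rightarrow> nat" where
  "cut u = (LEAST k. 0 < k \<and> alsw (drop k u))"

lemma cut_bounds:
  assumes "2 \<le> length u"
  shows "0 < cut u" "cut u < length u"
proof -
  have "drop (length u - 1) u = [last u]"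
    using assms by (cases u rule: rev_cases) auto
  then have "alsw (drop (length u - 1) u)"
    by (auto simp: alsw_def Cons_eq_append_conv)
  then have ex: "0 < length u - 1 \<and> alsw (drop (length u - 1) u)"
    using assms by auto
  have "0 < cut u \<and> alsw (drop (cut u) u)"
    unfolding cut_def using ex by (rule LeastI)
  then show "0 < cut u" "cut u < length u"
    by (auto simp: alsw_def)
qed

text \<open>The bracketing \<open>[u]\<close> as a non-associative word; it is used for ALSWs \<open>u\<close> only.\<close>

function nlsw :: "'x::linorder list \<Rightarrow> 'x nword" where
  "nlsw u = (if length u < 2 then Leaf (hd u)
             else Br (nlsw (take (cut u) u)) (nlsw (drop (cut u) u)))"
  by auto
termination
proof (relation "measure length")
  show "wf (measure length)" by simp
next
  fix u :: "'x::linorder list"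
  assume "\<not> length u < 2"
  then have "0 < cut u" "cut u < length u"
    using cut_bounds[of u] by auto
  then show "(take (cut u) u, u) \<in> measure length" "(drop (cut u) u, u) \<in> measure length"
    by auto
qed

declare nlsw.simps [simp del]

definition nlsw_poly :: "'x::linorder list \<Rightarrow> ('x, 'k::comm_ring_1) free_alg" where
  "nlsw_poly u = lie_eval (map_nword letter (nlsw u))"

section \<open>Leading words and special bracketing\<close>

definition lead :: "('x::wellorder, 'k::comm_ring_1) free_alg \<Rightarrow> 'x list" where
  "lead f = Max (Poly_Mapping.keys f)"

definition monic :: "('x::wellorder, 'k::comm_ring_1) free_alg \<Rightarrow> bool" where
  "monic f \<longleftrightarrow> f \<noteq> 0 \<and> Poly_Mapping.lookup f (lead f) = 1"

text \<open>
  \<open>replace_at r r' a b t t'\<close>: the leaves of \<open>t\<close> are \<open>a\<close>, then those of an occurrence of the subword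
  \<open>r\<close>, then \<open>b\<close>, and \<open>t'\<close> is \<open>t\<close> with this occurrence of \<open>r\<close> replaced by \<open>r'\<close>.
\<close>

inductive replace_at ::
  "'a nword \<Rightarrow> 'a nword \<Rightarrow> 'a list \<Rightarrow> 'a list \<Rightarrow> 'a nword \<Rightarrow> 'a nword \<Rightarrow> bool"
  for r r' where
  here: "replace_at r r' [] [] r r'"
| left: "replace_at r r' a b s s' \<Longrightarrow> replace_at r r' a (b @ fringe t) (Br s t) (Br s' t)"
| right: "replace_at r r' a b t t' \<Longrightarrow> replace_at r r' (fringe s @ a) b (Br s t) (Br s t')"

text \<open>
  \<open>special_bracketing a v b t\<close>: \<open>t\<close> is \<open>[avb]\<^sub>v\<close> for this occurrence of \<open>v\<close> in \<open>avb\<close>.  There may be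
  several \<open>c\<close> such that \<open>[vc]\<close> is a sub-bracket of \<open>[avb]\<close>; all of them are admitted.
\<close>

definition special_bracketing ::
  "'x::linorder list \<Rightarrow> 'x list \<Rightarrow> 'x list \<Rightarrow> 'x nword \<Rightarrow> bool" where
  "special_bracketing a v b t \<longleftrightarrow> alsw (a @ v @ b) \<and> alsw v \<and>
     (\<exists>c d cs. b = c @ d \<and> alsw (v @ c) \<and>
        c = concat cs \<and> (\<forall>e\<in>set cs. alsw e) \<and> sorted_wrt lex_le cs \<and>
        replace_at (nlsw (v @ c)) (foldl (\<lambda>r e. Br r (nlsw e)) (nlsw v) cs) a d
          (nlsw (a @ v @ b)) t)"

text \<open>\<open>special_poly a s b h\<close>: the Lie polynomial \<open>h\<close> is \<open>[asb]\<close> with respect to the leading word of \<open>s\<close>.\<close>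

definition special_poly ::
  "'x::wellorder list \<Rightarrow> ('x, 'k::comm_ring_1) free_alg \<Rightarrow> 'x list \<Rightarrow> ('x, 'k) free_alg \<Rightarrow> bool"
  where
  "special_poly a s b h \<longleftrightarrow>
     (\<exists>t t'. special_bracketing a (lead s) b t \<and>
        replace_at (map_nword letter (nlsw (lead s))) (Leaf s) (map letter a) (map letter b)
          (map_nword letter t) t' \<and>
        h = lie_eval t')"

section \<open>Groebner--Shirshov bases\<close>

definition inclusion_composition ::
  "('x::wellorder, 'k::comm_ring_1) free_alg \<Rightarrow> ('x, 'k) free_alg \<Rightarrow> 'x list \<Rightarrow> ('x, 'k) free_alg \<Rightarrow> bool"
  where
  "inclusion_composition f g w h \<longleftrightarrow>
     (\<exists>a b q. w = lead f \<and> w = a @ lead g @ b \<and> special_poly a g b q \<and> h = f - q)"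

definition intersection_composition ::
  "('x::wellorder, 'k::comm_ring_1) free_alg \<Rightarrow> ('x, 'k) free_alg \<Rightarrow> 'x list \<Rightarrow> ('x, 'k) free_alg \<Rightarrow> bool"
  where
  "intersection_composition f g w h \<longleftrightarrow>
     (\<exists>a b p q. w = lead f @ b \<and> w = a @ lead g \<and>
        length (lead f) + length (lead g) > length w \<and>
        special_poly [] f b p \<and> special_poly a g [] q \<and> h = p - q)"

text \<open>\<open>h\<close> is a normal \<open>S\<close>-word \<open>(asb)\<close> for some bracketing.\<close>

definition normal_word ::
  "'x::wellorder list \<Rightarrow> ('x, 'k::comm_ring_1) free_alg \<Rightarrow> 'x list \<Rightarrow> ('x, 'k) free_alg \<Rightarrow> bool"
  where
  "normal_word a s b h \<longleftrightarrow>
     (\<exists>t. fringe t = map letter a @ [s] @ map letter b \<and> h = lie_eval t) \<and>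
     alsw (a @ lead s @ b) \<and> h \<noteq> 0 \<and> lead h = a @ lead s @ b"

definition trivial_mod ::
  "('x::wellorder, 'k::comm_ring_1) free_alg set \<Rightarrow> 'x list \<Rightarrow> ('x, 'k) free_alg \<Rightarrow> bool" where
  "trivial_mod S w h \<longleftrightarrow>
     (\<exists>(n::nat) \<alpha> a s b q.
        h = (\<Sum>i<n. scale (\<alpha> i) (q i)) \<and>
        (\<forall>i<n. s i \<in> S \<and> normal_word (a i) (s i) (b i) (q i) \<and> a i @ lead (s i) @ b i < w))"

definition groebner_shirshov_basis :: "('x::wellorder, 'k::comm_ring_1) free_alg set \<Rightarrow> bool" where
  "groebner_shirshov_basis S \<longleftrightarrow>
     S \<subseteq> free_lie \<and> (\<forall>s\<in>S. monic s) \<and>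
     (\<forall>f\<in>S. \<forall>g\<in>S. \<forall>w h.
        inclusion_composition f g w h \<or> intersection_composition f g w h \<longrightarrow> trivial_mod S w h)"

definition irr :: "('x::wellorder, 'k::comm_ring_1) free_alg set \<Rightarrow> ('x, 'k) free_alg set" where
  "irr S = {nlsw_poly u | u. alsw u \<and> (\<forall>s\<in>S. \<forall>a b. u \<noteq> a @ lead s @ b)}"

section \<open>Free partially commutative Lie algebras\<close>

definition commutators :: "('x \<times> 'x) set \<Rightarrow> ('x, 'k::comm_ring_1) free_alg set" where
  "commutators \<theta> = {lie (letter a) (letter b) | a b. (a, b) \<in> \<theta>}"

definition tri :: "('x::wellorder \<times> 'x) set \<Rightarrow> 'x \<Rightarrow> 'x \<Rightarrow> bool" where
  "tri \<theta> a b \<longleftrightarrow> a > b \<and> ((a, b) \<in> \<theta> \<or> (b, a) \<in> \<theta>)"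

definition fpc_relations :: "('x::wellorder \<times> 'x) set \<Rightarrow> ('x, 'k::comm_ring_1) free_alg set" where
  "fpc_relations \<theta> =
     {nlsw_poly (x # u @ [y]) | x u y. tri \<theta> x y \<and> (\<forall>z\<in>set u. tri \<theta> y z)}"

end

theory Submission
  imports Defs Complex_Main "HOL-Library.Multiset"
begin

text \<open>
  Three facts about leading words carry the proof; no composition has to be computed.

  \<^item> The leading word of a nonzero Lie polynomial is an ALSW.  Indeed \<open>Lie(X)\<close> is spanned by the
    polynomials \<open>[u]\<close> (\<open>free_lie_eq_span\<close>, a rewriting of \<open>([u][v])\<close> by the Jacobi identity), and \<open>[u]\<close>
    is monic with leading word \<open>u\<close>.  The latter holds for every bracketing in which each node
    \<open>(s t)\<close> has words \<open>p, q\<close> with \<open>pq > qp\<close>, since then \<open>pq\<close> leads in \<open>st - ts\<close>.  Such bracketings are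
    called descending below.  They are stable under the exchange of sub-brackets with the same word,
    so that special bracketings \<open>[asb]\<close> are covered (\<open>special_poly_properties\<close>).

  \<^item> If \<open>a s\<^sup>- b\<close> is an ALSW, where \<open>s\<^sup>-\<close> denotes the leading word of \<open>s\<close>, then some normal word \<open>(asb)\<close>
    is monic with this leading word (\<open>ex_normal_word\<close>), since a descending bracketing arises when
    adjacent blocks \<open>p > q\<close> are bracketed together repeatedly; a nondecreasing product of at least two
    ALSWs is no ALSW, so this ends with a single block.

  \<^item> The leading word of a nonzero element of the ideal contains a factor \<open>xuy\<close> with
    \<open>x \<rhd> y \<rhd> supp(u)\<close> (\<open>lead_reducible\<close>).  The reason is that the ideal, which is generated
    by the commutators as well (\<open>lie_ideal_fpc_relations\<close>), vanishes in the algebra of the free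
    partially commutative monoid, whereas a word without such a factor is the smallest one of its class
    in this monoid (\<open>trace_equiv_less_factor\<close>).  Hence, if such a word led in \<open>h\<close>, the image of \<open>h\<close>
    would have the leading coefficient of \<open>h\<close> as a coefficient.

  Therefore a Lie polynomial can be reduced, term by term, to a combination of elements of \<open>Irr(S)\<close>
  modulo normal words that do not exceed its leading word (\<open>reduction\<close>), and for elements of the
  ideal this combination is zero.  This shows that \<open>Irr(S)\<close> yields a basis.  A composition \<open>(f, g)\<close>
  with respect to \<open>w\<close> is a difference of two monic elements of the ideal, both with leading word \<open>w\<close>.
  So its leading word is smaller than \<open>w\<close>, and its reduction shows that it is trivial.
\<close>

section \<open>The lexicographic order\<close>

lemma lex_less_irrefl [simp]: "\<not> lex_less u u"
  by (induction u) auto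

lemma lex_less_trans: "lex_less u v \<Longrightarrow> lex_less v w \<Longrightarrow> lex_less u w"
proof (induction u v arbitrary: w rule: lex_less.induct)
  case (3 a u b v)
  then show ?case by (cases w) auto
qed auto

lemma lex_less_linear: "lex_less u v \<or> u = v \<or> lex_less v u"
proof (induction u v rule: lex_less.induct)
  case (1 v)
  then show ?case by (cases v) auto
qed auto

lemma lex_less_asym: "lex_less u v \<Longrightarrow> \<not> lex_less v u"
  using lex_less_trans lex_less_irrefl by blast

lemma lex_le_iff_not_less: "lex_le u v \<longleftrightarrow> \<not> lex_less v u"
  unfolding lex_le_def using lex_less_linear lex_less_asym lex_less_irrefl by blast

lemma lex_le_less_trans: "lex_le u v \<Longrightarrow> lex_less v w \<Longrightarrow> lex_less u w"
  unfolding lex_le_def using lex_less_trans by blast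

lemma lex_le_trans: "lex_le u v \<Longrightarrow> lex_le v w \<Longrightarrow> lex_le u w"
  unfolding lex_le_def using lex_less_trans by blast

lemma lex_less_append_iff [simp]: "lex_less (p @ u) (p @ v) \<longleftrightarrow> lex_less u v"
  by (induction p) auto

lemma lex_less_append_self: "x \<noteq> [] \<Longrightarrow> lex_less (u @ x) u"
  by (induction u) (auto simp: neq_Nil_conv)

lemma not_lex_less_append_self: "\<not> lex_less u (u @ x)"
  by (induction u) auto

text \<open>If the smaller word is not the longer one, the words differ at some letter, hence the
  inequality survives arbitrary prolongations of both sides.\<close>

lemma lex_less_prolong:
  "lex_less u v \<Longrightarrow> length u \<le> length v \<Longrightarrow> lex_less (u @ x) (v @ y)"
  by (induction u v rule: lex_less.induct) auto

text \<open>A prefix of the right-hand side decides the comparison if it is at least as long as the left-hand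
  side.\<close>

lemma lex_less_truncate:
  "lex_less u (v @ z) \<Longrightarrow> length u \<le> length v \<Longrightarrow> lex_less (u @ x) v"
  by (induction u v rule: lex_less.induct) auto

lemma lex_less_cases:
  assumes "lex_less u v"
  obtains "\<And>x y. lex_less (u @ x) (v @ y)" | x where "x \<noteq> []" "u = v @ x"
proof -
  have "(\<forall>x y. lex_less (u @ x) (v @ y)) \<or> (\<exists>x. x \<noteq> [] \<and> u = v @ x)"
    using assms by (induction u v rule: lex_less.induct) auto
  then show ?thesis using that by blast
qed

lemma lex_less_iff_less:
  "length u = length v \<Longrightarrow> lex_less u v \<longleftrightarrow> u < v"
  by (induction u v rule: lex_less.induct) (auto simp: Cons_less_Cons)

lemma sorted_wrt_lex_le_snoc:
  assumes "sorted_wrt lex_le (ds @ [d])" "lex_le d q"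
  shows "sorted_wrt lex_le ((ds @ [d]) @ [q])"
proof -
  have "lex_le e q" if "e \<in> set ds" for e
    using that assms lex_le_trans[of e d q] by (auto simp: sorted_wrt_append)
  then show ?thesis using assms by (auto simp: sorted_wrt_append)
qed

section \<open>Associative Lyndon--Shirshov words\<close>

lemma alsw_singleton [simp]: "alsw [a]"
  by (auto simp: alsw_def Cons_eq_append_conv)

lemma alsw_not_Nil: "alsw u \<Longrightarrow> u \<noteq> []"
  by (simp add: alsw_def)

lemma alsw_rotate: "alsw (u @ v) \<Longrightarrow> u \<noteq> [] \<Longrightarrow> v \<noteq> [] \<Longrightarrow> lex_less (v @ u) (u @ v)"
  by (simp add: alsw_def)

text \<open>A suffix \<open>w\<close> of an ALSW \<open>vw\<close> that is a prefix as well, \<open>vw = wx\<close>, would give both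
  \<open>v < x\<close> and \<open>x < v\<close>, by comparing the two rotations with the word.\<close>

lemma alsw_suffix_less:
  assumes "alsw (v @ w)" "v \<noteq> []" "w \<noteq> []"
  shows "lex_less w (v @ w)"
proof (rule ccontr)
  assume "\<not> lex_less w (v @ w)"
  then have "lex_less (v @ w) w"
    using lex_less_linear[of w "v @ w"] assms(2) by auto
  then show False
  proof (cases rule: lex_less_cases)
    case 1
    have "lex_less (v @ w) (w @ v)" using 1[of "[]" v] by simp
    with alsw_rotate[OF assms] show False using lex_less_asym by blast
  next
    case (2 x)
    have len: "length x = length v" using arg_cong[OF 2(2), of length] by simp
    have "lex_less (w @ v) (w @ x)" using alsw_rotate[OF assms] 2(2) by simp
    then have "lex_less v x" by simp
    moreover have "w @ x = v @ w" using 2(2) by simp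
    then have "lex_less (x @ w) (v @ w)"
      using alsw_rotate[of w x] assms 2(1) by metis
    then have "lex_less x v"
      using lex_less_prolong[of v x w w] len lex_less_linear[of v x] lex_less_asym lex_less_irrefl
      by (metis le_refl)
    ultimately show False using lex_less_asym by blast
  qed
qed

lemma alsw_if_suffixes_less:
  assumes "u \<noteq> []" "\<And>v w. v \<noteq> [] \<Longrightarrow> w \<noteq> [] \<Longrightarrow> u = v @ w \<Longrightarrow> lex_less w u"
  shows "alsw u"
  unfolding alsw_def
proof (intro conjI allI impI)
  fix v w assume *: "v \<noteq> []" "w \<noteq> []" "u = v @ w"
  then have "lex_less w (v @ w)" using assms(2) by blast
  then have "lex_less (w @ v) ((v @ w) @ [])" by (rule lex_less_prolong) simp
  then show "lex_less (w @ v) (v @ w)" by simp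
qed (fact assms(1))

text \<open>If \<open>p\<close> is a proper prefix of \<open>q = px\<close>, the suffix \<open>x\<close> is smaller than \<open>q\<close>, hence \<open>q = px < pq\<close>;
  otherwise \<open>p\<close> and \<open>q\<close> differ at some letter.\<close>

lemma alsw_append:
  assumes p: "alsw p" and q: "alsw q" and less: "lex_less q p"
  shows "alsw (p @ q)"
proof (rule alsw_if_suffixes_less)
  show "p @ q \<noteq> []" using alsw_not_Nil[OF p] by simp
  have qpq: "lex_less q (p @ q)"
    using less
  proof (cases rule: lex_less_cases)
    case 1
    from 1[of "[]" q] show ?thesis by simp
  next
    case (2 x)
    then have "lex_less x q" using alsw_suffix_less[of p x] q alsw_not_Nil[OF p] by simp
    then show ?thesis using 2(2) by simp
  qed
  fix v w assume vw: "v \<noteq> []" "w \<noteq> []" "p @ q = v @ w"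
  then consider z where "p @ z = v" "q = z @ w" | z where "p = v @ z" "z \<noteq> []" "z @ q = w"
    unfolding append_eq_append_conv2 by fastforce
  then show "lex_less w (p @ q)"
  proof cases
    case 1
    then have "lex_le w q" using alsw_suffix_less[of z w] q vw(2) by (cases "z = []") (auto simp: lex_le_def)
    then show ?thesis using qpq by (rule lex_le_less_trans)
  next
    case 2
    then have "lex_less z p" using alsw_suffix_less[of v z] p vw(1) by simp
    then have "lex_less (z @ q) (p @ q)" using 2 by (intro lex_less_prolong) auto
    then show ?thesis using 2 by simp
  qed
qed

text \<open>The last factor of a nondecreasing product is at least the first one, which is a prefix of
  the product and therefore at least the product, whereas suffixes of an ALSW are smaller.\<close>

lemma not_alsw_concat_sorted:
  assumes "sorted_wrt lex_le (p # ps)" "ps \<noteq> []" "\<And>e. e \<in> set (p # ps) \<Longrightarrow> alsw e"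
  shows "\<not> alsw (concat (p # ps))"
proof
  assume a: "alsw (concat (p # ps))"
  obtain qs q where ps: "ps = qs @ [q]" using assms(2) by (cases ps rule: rev_cases) auto
  have "p \<noteq> []" "q \<noteq> []" using assms(3) ps alsw_not_Nil by auto
  then have "lex_less q (concat (p # ps))"
    using alsw_suffix_less[of "p @ concat qs" q] a ps by simp
  moreover have "lex_le p q" using assms(1) ps by simp
  ultimately have "lex_less p (p @ concat ps)" by (simp add: lex_le_less_trans)
  then show False by (simp add: not_lex_less_append_self)
qed

section \<open>Bracketings whose leading words are visible\<close>

text \<open>\<open>k\<close> assigns to each leaf the word that it stands for.\<close>

primrec tree_word :: "('a \<Rightarrow> 'x list) \<Rightarrow> 'a nword \<Rightarrow> 'x list" where
  "tree_word k (Leaf a) = k a"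
| "tree_word k (Br s t) = tree_word k s @ tree_word k t"

text \<open>At each node the product in the given order is the larger one; this makes the leading word of
  the Lie product the product of the leading words.\<close>

primrec descending :: "('a \<Rightarrow> 'x::linorder list) \<Rightarrow> 'a nword \<Rightarrow> bool" where
  "descending k (Leaf a) \<longleftrightarrow> True"
| "descending k (Br s t) \<longleftrightarrow> descending k s \<and> descending k t \<and>
     lex_less (tree_word k t @ tree_word k s) (tree_word k s @ tree_word k t)"

lemma tree_word_eq: "tree_word k t = concat (map k (fringe t))"
  by (induction t) auto

lemma tree_word_singleton [simp]: "tree_word (\<lambda>x. [x]) = fringe"
proof
  show "tree_word (\<lambda>x. [x]) t = fringe t" for t :: "'a nword"
    by (induction t) auto
qed

lemma tree_word_map: "tree_word k (map_nword f t) = tree_word (k \<circ> f) t"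
  by (induction t) auto

lemma descending_map: "descending k (map_nword f t) = descending (k \<circ> f) t"
  by (induction t) (simp_all add: tree_word_map comp_def)

lemma fringe_map: "fringe (map_nword f t) = map f (fringe t)"
  by (induction t) auto

lemma replace_at_fringe:
  "replace_at r r' a b t t' \<Longrightarrow> fringe t = a @ fringe r @ b \<and> fringe t' = a @ fringe r' @ b"
  by (induction rule: replace_at.induct) auto

text \<open>A node only refers to the words of its two subtrees, so a sub-bracket may be exchanged for any
  descending one with the same word.\<close>

lemma replace_at_descending:
  assumes "replace_at r r' a b t t'" "descending k t" "descending k r'"
    "tree_word k r' = tree_word k r"
  shows "descending k t' \<and> tree_word k t' = tree_word k t"
  using assms by (induction rule: replace_at.induct) auto

lemma sorted_wrt_append_cases:
  assumes "transp R" "\<not> sorted_wrt R xs"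
  shows "\<exists>us x y vs. xs = us @ x # y # vs \<and> \<not> R x y"
  using assms(2)
proof (induction xs)
  case (Cons x xs)
  show ?case
  proof (cases "sorted_wrt R xs")
    case True
    then obtain y ys where xs: "xs = y # ys" using Cons.prems by (cases xs) auto
    have "\<not> R x y"
    proof
      assume "R x y"
      then have "sorted_wrt R (x # xs)"
        using True assms(1) unfolding xs by (auto dest: transpD)
      then show False using Cons.prems by simp
    qed
    then have "x # xs = [] @ x # y # ys \<and> \<not> R x y" using xs by simp
    then show ?thesis by blast
  next
    case False
    then obtain us y z vs where "xs = us @ y # z # vs \<and> \<not> R y z" using Cons.IH by blast
    then have "x # xs = (x # us) @ y # z # vs \<and> \<not> R y z" by simp
    then show ?thesis by blast
  qed
qed simp

lemma transp_lex_le: "transp lex_le"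
  using lex_le_trans by (auto intro: transpI)

text \<open>As long as some block is larger than its right neighbour, the two can be bracketed together
  into a longer ALSW.\<close>

lemma merge_blocks:
  assumes "\<And>t. t \<in> set ts \<Longrightarrow> descending k t \<and> alsw (tree_word k t)"
  shows "\<exists>ts'. concat (map fringe ts') = concat (map fringe ts) \<and>
    (\<forall>t\<in>set ts'. descending k t \<and> alsw (tree_word k t)) \<and>
    sorted_wrt lex_le (map (tree_word k) ts')"
  using assms
proof (induction ts rule: length_induct)
  case (1 ts)
  show ?case
  proof (cases "sorted_wrt lex_le (map (tree_word k) ts)")
    case True
    then show ?thesis using 1(2) by blast
  next
    case False
    then obtain us x y vs where "map (tree_word k) ts = us @ x # y # vs" "\<not> lex_le x y"
      using sorted_wrt_append_cases[OF transp_lex_le] by blast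
    then obtain us' s t vs' where ts: "ts = us' @ s # t # vs'"
      and st: "\<not> lex_le (tree_word k s) (tree_word k t)"
      by (auto simp: map_eq_append_conv map_eq_Cons_conv)
    have s: "descending k s" "alsw (tree_word k s)" and t: "descending k t" "alsw (tree_word k t)"
      using 1(2) ts by auto
    have less: "lex_less (tree_word k t) (tree_word k s)" using st by (simp add: lex_le_iff_not_less)
    then have a: "alsw (tree_word k s @ tree_word k t)" using s t alsw_append by blast
    then have d: "descending k (Br s t)"
      using s t alsw_rotate[OF a] alsw_not_Nil by auto
    let ?ts = "us' @ Br s t # vs'"
    have "length ?ts < length ts" using ts by simp
    moreover have "\<And>r. r \<in> set ?ts \<Longrightarrow> descending k r \<and> alsw (tree_word k r)"
      using 1(2) ts a d by auto
    moreover have "concat (map fringe ?ts) = concat (map fringe ts)" using ts by simp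
    ultimately show ?thesis using 1(1) by metis
  qed
qed

text \<open>Merging, started from the letters.\<close>

lemma alsw_factorization:
  "\<exists>cs. concat cs = w \<and> (\<forall>c\<in>set cs. alsw c) \<and> sorted_wrt lex_le cs"
proof -
  have "\<exists>ts'. concat (map fringe ts') = concat (map fringe (map Leaf w)) \<and>
    (\<forall>t\<in>set ts'. descending (\<lambda>x. [x]) t \<and> alsw (tree_word (\<lambda>x. [x]) t)) \<and>
    sorted_wrt lex_le (map (tree_word (\<lambda>x. [x])) ts')"
    by (rule merge_blocks) auto
  then obtain ts' where ts': "concat (map fringe ts') = concat (map fringe (map Leaf w))"
    "\<forall>t\<in>set ts'. alsw (fringe t)" "sorted_wrt lex_le (map fringe ts')"
    by (auto simp del: map_map)
  have "concat (map fringe (map Leaf w)) = w" by (induction w) auto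
  then show ?thesis using ts' by (intro exI[of _ "map fringe ts'"]) auto
qed

text \<open>When the product of the leaf words is an ALSW, merging cannot stop with several blocks.\<close>

lemma ex_descending_bracketing:
  assumes "\<And>x. x \<in> set xs \<Longrightarrow> alsw (k x)" "alsw (concat (map k xs))"
  shows "\<exists>t. fringe t = xs \<and> descending k t"
proof -
  have "\<exists>ts'. concat (map fringe ts') = concat (map fringe (map Leaf xs)) \<and>
    (\<forall>t\<in>set ts'. descending k t \<and> alsw (tree_word k t)) \<and>
    sorted_wrt lex_le (map (tree_word k) ts')"
    using assms(1) by (intro merge_blocks) auto
  then obtain ts' where ts': "concat (map fringe ts') = concat (map fringe (map Leaf xs))"
    "\<forall>t\<in>set ts'. descending k t \<and> alsw (tree_word k t)" "sorted_wrt lex_le (map (tree_word k) ts')"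
    by blast
  have "concat (map fringe (map Leaf xs)) = xs" by (induction xs) auto
  with ts' have xs: "concat (map fringe ts') = xs" by simp
  have "concat (map (tree_word k) ts') = concat (map k (concat (map fringe ts')))"
    by (induction ts') (auto simp: tree_word_eq)
  then have c: "alsw (concat (map (tree_word k) ts'))" using xs assms(2) by simp
  then obtain t rs where t: "ts' = t # rs" by (cases ts') (auto dest: alsw_not_Nil)
  have "rs = []"
    using not_alsw_concat_sorted[of "tree_word k t" "map (tree_word k) rs"] c ts' unfolding t by auto
  then show ?thesis using xs ts' t by auto
qed

section \<open>The bracketing of an associative Lyndon--Shirshov word\<close>

lemma alsw_drop_cut:
  assumes "2 \<le> length u"
  shows "alsw (drop (cut u) u)"
proof -
  have "drop (length u - 1) u = [last u]"
    using assms by (cases u rule: rev_cases) auto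
  then have "0 < length u - 1 \<and> alsw (drop (length u - 1) u)"
    using assms by auto
  then have "0 < cut u \<and> alsw (drop (cut u) u)"
    unfolding cut_def by (rule LeastI)
  then show ?thesis ..
qed

lemma cut_le: "0 < k \<Longrightarrow> alsw (drop k u) \<Longrightarrow> cut u \<le> k"
  unfolding cut_def by (rule Least_le) simp

text \<open>If the complement of the longest ALSW suffix \<open>q\<close> had several ALSW factors, its last factor
  would either lengthen \<open>q\<close> or extend to a nondecreasing factorization of the whole word.\<close>

lemma alsw_take_cut:
  assumes u: "alsw u" "2 \<le> length u"
  shows "alsw (take (cut u) u)"
proof -
  define p q where "p = take (cut u) u" and "q = drop (cut u) u"
  have pq: "u = p @ q" "p \<noteq> []" "alsw q" "length p = cut u"
    using cut_bounds[OF u(2)] alsw_drop_cut[OF u(2)] by (auto simp: p_def q_def)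
  obtain cs where cs: "concat cs = p" "\<forall>c\<in>set cs. alsw c" "sorted_wrt lex_le cs"
    using alsw_factorization by metis
  have "cs \<noteq> []" using cs(1) pq(2) by auto
  then obtain ds d where ds: "cs = ds @ [d]" by (cases cs rule: rev_cases) auto
  have "alsw d" using cs(2) ds by auto
  have "ds = []"
  proof (rule ccontr)
    assume ne: "ds \<noteq> []"
    show False
    proof (cases "lex_le d q")
      case True
      obtain d1 ds' where ds1: "ds = d1 # ds'" using ne by (cases ds) auto
      have "sorted_wrt lex_le (cs @ [q])"
        using cs(3) True unfolding ds by (rule sorted_wrt_lex_le_snoc)
      then have sorted: "sorted_wrt lex_le (d1 # (ds' @ [d, q]))" unfolding ds ds1 by simp
      have "alsw e" if "e \<in> set (d1 # (ds' @ [d, q]))" for e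
        using that cs(2) \<open>alsw q\<close> unfolding ds ds1 by auto
      then have "\<not> alsw (concat (d1 # (ds' @ [d, q])))"
        using not_alsw_concat_sorted[OF sorted] by blast
      moreover have "concat (d1 # (ds' @ [d, q])) = u" using cs(1) pq(1) ds ds1 by auto
      ultimately show False using u(1) by simp
    next
      case False
      then have "alsw (d @ q)" using alsw_append \<open>alsw d\<close> \<open>alsw q\<close> by (simp add: lex_le_iff_not_less)
      moreover have "drop (length (concat ds)) u = d @ q" using cs(1) ds pq(1) by auto
      moreover have "concat ds \<noteq> []"
        using ne cs(2) alsw_not_Nil[of "hd ds"] unfolding ds by (cases ds) auto
      ultimately have "cut u \<le> length (concat ds)"
        using cut_le[of "length (concat ds)" u] by (simp del: concat_eq_Nil_conv)
      moreover have "length p = length (concat ds) + length d" using cs(1) ds by auto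
      ultimately show False using pq(4) alsw_not_Nil[OF \<open>alsw d\<close>] by simp
    qed
  qed
  then show ?thesis using cs(1) \<open>alsw d\<close> ds by (simp add: p_def)
qed

lemma nlsw_short: "length u < 2 \<Longrightarrow> nlsw u = Leaf (hd u)"
  by (simp add: nlsw.simps)

lemma nlsw_Br:
  "2 \<le> length u \<Longrightarrow> nlsw u = Br (nlsw (take (cut u) u)) (nlsw (drop (cut u) u))"
  by (subst nlsw.simps) simp

lemma fringe_nlsw: "u \<noteq> [] \<Longrightarrow> fringe (nlsw u) = u"
proof (induction u rule: length_induct)
  case (1 u)
  show ?case
  proof (cases "length u < 2")
    case True
    then show ?thesis using 1(2) by (cases u) (auto simp: nlsw_short)
  next
    case False
    then have len: "2 \<le> length u" by simp
    note b = cut_bounds[OF len]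
    have "fringe (nlsw (take (cut u) u)) = take (cut u) u"
      and "fringe (nlsw (drop (cut u) u)) = drop (cut u) u"
      using 1(1)[rule_format, of "take (cut u) u"] 1(1)[rule_format, of "drop (cut u) u"] b 1(2)
      by auto
    then show ?thesis by (simp add: nlsw_Br[OF len])
  qed
qed

lemma descending_nlsw: "alsw u \<Longrightarrow> descending (\<lambda>x. [x]) (nlsw u)"
proof (induction u rule: length_induct)
  case (1 u)
  show ?case
  proof (cases "length u < 2")
    case True
    then show ?thesis by (auto simp: nlsw_short)
  next
    case False
    then have len: "2 \<le> length u" by simp
    note b = cut_bounds[OF len]
    let ?p = "take (cut u) u" and ?q = "drop (cut u) u"
    have ne: "?p \<noteq> []" "?q \<noteq> []" using b by auto
    have less: "lex_less (?q @ ?p) (?p @ ?q)"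
      using ne 1(2) by (intro alsw_rotate) simp_all
    have "descending (\<lambda>x. [x]) (nlsw ?p)"
      using 1(1) b alsw_take_cut[OF 1(2) len] by simp
    moreover have "descending (\<lambda>x. [x]) (nlsw ?q)"
      using 1(1) b alsw_drop_cut[OF len] by simp
    ultimately show ?thesis
      unfolding nlsw_Br[OF len] using less fringe_nlsw[OF ne(1)] fringe_nlsw[OF ne(2)]
      by (simp del: append_take_drop_id)
  qed
qed

text \<open>An ALSW suffix of \<open>uv\<close> longer than \<open>v\<close> would consist of a nonempty suffix of \<open>u\<close> and \<open>v\<close>.  The
  last ALSW factor of the former is a suffix of \<open>q\<close>, where \<open>u = pq\<close> is the standard factorization,
  so it is at most \<open>q\<close>, hence at most \<open>v\<close>, and the suffix has a nondecreasing factorization.\<close>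

lemma cut_append:
  assumes u: "alsw u" and v: "alsw v"
    and std: "2 \<le> length u \<Longrightarrow> lex_le (drop (cut u) u) v"
  shows "cut (u @ v) = length u"
proof (rule antisym)
  show "cut (u @ v) \<le> length u" using alsw_not_Nil[OF u] v by (intro cut_le) auto
  show "length u \<le> cut (u @ v)"
  proof (rule ccontr)
    assume less: "\<not> length u \<le> cut (u @ v)"
    have len: "2 \<le> length (u @ v)"
      using alsw_not_Nil[OF u] alsw_not_Nil[OF v] by (cases u; cases v) auto
    let ?z = "drop (cut (u @ v)) u"
    have z: "?z \<noteq> []" "alsw (?z @ v)" using less alsw_drop_cut[OF len] by auto
    have pos: "0 < cut (u @ v)" using cut_bounds[OF len] by simp
    have len2: "2 \<le> length u" using less pos by simp
    obtain cs where cs: "concat cs = ?z" "\<forall>c\<in>set cs. alsw c" "sorted_wrt lex_le cs"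
      using alsw_factorization by metis
    have "cs \<noteq> []" using cs(1) z(1) by auto
    then obtain ds d where ds: "cs = ds @ [d]" by (cases cs rule: rev_cases) auto
    have "alsw d" using cs(2) ds by auto
    obtain a where a: "u = a @ d" "a \<noteq> []"
    proof
      show "u = (take (cut (u @ v)) u @ concat ds) @ d"
        using append_take_drop_id[of "cut (u @ v)" u] cs(1) unfolding ds by simp
      show "take (cut (u @ v)) u @ concat ds \<noteq> []" using pos alsw_not_Nil[OF u] by simp
    qed
    define l where "l = length a"
    have l: "0 < l" "drop l u = d" using a by (simp_all add: l_def)
    then have cutl: "cut u \<le> l" using cut_le \<open>alsw d\<close> by metis
    have "lex_le d (drop (cut u) u)"
    proof (cases "l = cut u")
      case True
      then show ?thesis using l by (simp add: lex_le_def)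
    next
      case False
      let ?q = "drop (cut u) u"
      have split: "take (l - cut u) ?q @ d = ?q"
        using append_take_drop_id[of "l - cut u" ?q] cutl l(2) by simp
      have "length d < length ?q" using False cutl l alsw_not_Nil[OF \<open>alsw d\<close>] by auto
      then have "take (l - cut u) ?q \<noteq> []" using split by (intro notI) simp
      then have "lex_less d ?q"
        using alsw_suffix_less[of "take (l - cut u) ?q" d] alsw_drop_cut[OF len2]
          alsw_not_Nil[OF \<open>alsw d\<close>] unfolding split by blast
      then show ?thesis by (simp add: lex_le_def)
    qed
    then have dv: "lex_le d v" using std[OF len2] lex_le_trans by blast
    have sorted: "sorted_wrt lex_le (cs @ [v])"
      using cs(3) dv unfolding ds by (rule sorted_wrt_lex_le_snoc)
    obtain c cs' where cs': "cs = c # cs'" using \<open>cs \<noteq> []\<close> by (cases cs) auto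
    have "alsw e" if "e \<in> set (c # (cs' @ [v]))" for e
      using that cs(2) v unfolding cs' by auto
    then have "\<not> alsw (concat (c # (cs' @ [v])))"
      using not_alsw_concat_sorted[of c "cs' @ [v]"] sorted unfolding cs' by simp
    then show False using z(2) unfolding cs(1)[symmetric] cs' by simp
  qed
qed

lemma nlsw_append:
  assumes u: "alsw u" and v: "alsw v"
    and "2 \<le> length u \<Longrightarrow> lex_le (drop (cut u) u) v"
  shows "nlsw (u @ v) = Br (nlsw u) (nlsw v)"
proof -
  have "2 \<le> length (u @ v)"
    using alsw_not_Nil[OF u] alsw_not_Nil[OF v] by (cases u; cases v) auto
  then show ?thesis using cut_append[OF assms] by (simp add: nlsw_Br)
qed

section \<open>Linear structure and leading words of Lie polynomials\<close>

lemma lookup_scale [simp]: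
  "Poly_Mapping.lookup (scale c f) w = c * Poly_Mapping.lookup f w"
  by (simp add: scale_def Poly_Mapping.map.rep_eq when_def)

interpretation fa: Modules.module "scale :: 'k::comm_ring_1 \<Rightarrow> ('x, 'k) free_alg \<Rightarrow> ('x, 'k) free_alg"
  by standard (auto intro!: poly_mapping_eqI simp: lookup_add algebra_simps)

lemma scale_eq_single_mult: "scale c f = Poly_Mapping.single [] c * f"
  unfolding scale_def using mult_map_scale_conv_mult[of c f] by (simp add: zero_list_def)

lemma scale_mult_left: "scale c f * g = scale c (f * g)"
  by (simp add: scale_eq_single_mult mult.assoc)

lemma poly_mapping_plus_single_induct [case_names zero plus_single]:
  fixes f :: "'a \<Rightarrow>\<^sub>0 'b::comm_monoid_add"
  assumes "P 0" "\<And>f a c. P f \<Longrightarrow> P (f + Poly_Mapping.single a c)"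
  shows "P f"
proof (induction f rule: update_induct)
  case (update f a b)
  have "Poly_Mapping.update a b f = f + Poly_Mapping.single a b"
    using update(1) by (intro poly_mapping_eqI)
      (auto simp: lookup_add lookup_single when_def lookup_update not_in_keys_iff_lookup_eq_zero)
  then show ?case using update(3) assms(2) by simp
qed (fact assms(1))

lemma single_Nil_commute:
  fixes f :: "('x, 'k::comm_ring_1) free_alg"
  shows "f * Poly_Mapping.single [] c = Poly_Mapping.single [] c * f"
  by (induction f rule: poly_mapping_plus_single_induct)
    (simp_all add: algebra_simps mult_single plus_list_def)

lemma scale_mult_right: "f * scale c g = scale c (f * g)"
proof -
  have "f * scale c g = (f * Poly_Mapping.single [] c) * g"
    by (simp add: scale_eq_single_mult mult.assoc)
  also have "\<dots> = scale c (f * g)"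
    unfolding single_Nil_commute by (simp add: scale_eq_single_mult mult.assoc)
  finally show ?thesis .
qed

lemma lie_add_left: "lie (f + g) h = lie f h + lie g h"
  by (simp add: lie_def algebra_simps)

lemma lie_add_right: "lie f (g + h) = lie f g + lie f h"
  by (simp add: lie_def algebra_simps)

lemma lie_scale_left: "lie (scale c f) g = scale c (lie f g)"
  by (simp add: lie_def scale_mult_left scale_mult_right fa.scale_right_diff_distrib)

lemma lie_scale_right: "lie f (scale c g) = scale c (lie f g)"
  by (simp add: lie_def scale_mult_left scale_mult_right fa.scale_right_diff_distrib)

lemma lie_zero [simp]: "lie 0 f = 0" "lie f 0 = 0"
  by (simp_all add: lie_def)

lemma lie_self [simp]: "lie f f = 0"
  by (simp add: lie_def)

lemma lie_swap: "lie f g = scale (- 1) (lie g f)"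
  by (simp add: lie_def)

lemma lie_jacobi: "lie (lie f g) h = lie (lie f h) g + lie f (lie g h)"
  by (simp add: lie_def algebra_simps)

lemma subspace_free_lie: "fa.subspace free_lie"
  by (intro fa.subspaceI free_lie.intros)

lemma subspace_lie_ideal: "fa.subspace (lie_ideal T)"
  by (intro fa.subspaceI lie_ideal.zero lie_ideal.add lie_ideal.scale)

lemma lie_mem_span:
  assumes "f \<in> fa.span A" "g \<in> fa.span B" "\<And>a b. a \<in> A \<Longrightarrow> b \<in> B \<Longrightarrow> lie a b \<in> fa.span C"
  shows "lie f g \<in> fa.span C"
  using assms(1)
proof (induction rule: fa.span_induct_alt)
  case (step c a f)
  have "lie a g \<in> fa.span C"
    using assms(2)
  proof (induction rule: fa.span_induct_alt)
    case (step d b g)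
    then show ?case
      using assms(3) \<open>a \<in> A\<close> by (simp add: lie_add_right lie_scale_right fa.span_add fa.span_scale)
  qed (simp add: fa.span_zero)
  then show ?case
    using step by (simp add: lie_add_left lie_scale_left fa.span_add fa.span_scale)
qed (simp add: fa.span_zero)

lemma deglex_append_mono:
  fixes p q r s :: "'x::linorder list"
  assumes "p \<le> r" "q \<le> s"
  shows "p @ q \<le> r @ s" "p @ q = r @ s \<Longrightarrow> p = r \<and> q = s"
proof -
  have short: "u < v" if "length u < length v" for u v :: "'x list"
    using that by (cases u; cases v) (auto simp: Cons_less_Cons)
  have right: "u @ z < v @ z" if "u < v" for u v z :: "'x list"
    using that
  proof (induction u v rule: lex_less.induct)
    case (1 v)
    then have "v \<noteq> []" by auto
    then show ?case by (intro short) simp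
  qed (auto simp: Cons_less_Cons)
  have left: "z @ u < z @ v" if "u < v" for u v z :: "'x list"
    using that
  proof (induction z)
    case (Cons a z)
    have "length (z @ u) \<le> length (z @ v)"
      using that by (cases u; cases v) (auto simp: Cons_less_Cons)
    then show ?case using Cons by (auto simp: Cons_less_Cons)
  qed simp
  have less: "p @ q < r @ s" if "p < r \<or> q < s"
  proof (cases "p < r")
    case True
    have "r @ q \<le> r @ s" using assms(2) left[of q s r] by (auto simp: order.order_iff_strict)
    with right[OF True, of q] show ?thesis by (rule less_le_trans)
  next
    case False
    then have "p = r" "q < s" using that assms(1) by auto
    then show ?thesis using left by blast
  qed
  show "p @ q \<le> r @ s"
    using assms less by (cases "p = r \<and> q = s") (auto simp: order.order_iff_strict)
  show "p = r \<and> q = s" if "p @ q = r @ s"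
    using assms less that by (auto simp: order.order_iff_strict)
qed

lemma lead_mem_keys: "f \<noteq> 0 \<Longrightarrow> lead f \<in> Poly_Mapping.keys f"
  unfolding lead_def by (rule Max_in) auto

lemma keys_le_lead: "w \<in> Poly_Mapping.keys f \<Longrightarrow> w \<le> lead f"
  unfolding lead_def by (rule Max_ge) auto

lemma lead_eqI:
  "w \<in> Poly_Mapping.keys f \<Longrightarrow> (\<And>v. v \<in> Poly_Mapping.keys f \<Longrightarrow> v \<le> w) \<Longrightarrow> lead f = w"
  unfolding lead_def by (rule Max_eqI) auto

lemma monicI:
  assumes "Poly_Mapping.lookup f w = (1 :: 'k::comm_ring_1)"
    "\<And>v. v \<in> Poly_Mapping.keys f \<Longrightarrow> v \<le> w"
  shows "monic f \<and> lead f = w"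
proof -
  have w: "w \<in> Poly_Mapping.keys f" using assms(1) by (simp add: in_keys_iff)
  then have "lead f = w" using assms(2) by (intro lead_eqI)
  then show ?thesis using w assms(1) by (auto simp: monic_def)
qed

lemma monic_letter: "monic (letter x :: ('x::wellorder, 'k::comm_ring_1) free_alg)"
  and lead_letter [simp]: "lead (letter x :: ('x, 'k) free_alg) = [x]"
  using monicI[of "letter x :: ('x, 'k) free_alg" "[x]"]
  by (auto simp: letter_def split: if_splits)

text \<open>Concatenation is strictly monotone for deg-lex in both arguments, so the product of the
  leading words arises from the leading terms only; the constant \<open>1\<close> survives multiplication over any ring.\<close>

lemma monic_mult:
  fixes f g :: "('x::wellorder, 'k::comm_ring_1) free_alg"
  assumes "monic f" "monic g"
  shows "monic (f * g) \<and> lead (f * g) = lead f @ lead g"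
proof (rule monicI)
  let ?p = "lead f" and ?q = "lead g"
  have le: "v \<le> ?p @ ?q" if "v \<in> Poly_Mapping.keys (f * g)" for v
  proof -
    obtain a b where "v = a + b" "a \<in> Poly_Mapping.keys f" "b \<in> Poly_Mapping.keys g"
      using \<open>v \<in> _\<close> keys_mult[of f g] by auto
    then show ?thesis using deglex_append_mono(1) keys_le_lead by (metis plus_list_def)
  qed
  then show "v \<le> ?p @ ?q" if "v \<in> Poly_Mapping.keys (f * g)" for v using that .
  define f' where "f' = f - Poly_Mapping.single ?p 1"
  have f: "f = Poly_Mapping.single ?p 1 + f'" by (simp add: f'_def)
  have f0: "Poly_Mapping.lookup f' ?p = 0"
    using assms(1) by (simp add: f'_def lookup_minus monic_def)
  have f1: "a \<le> ?p \<and> a \<noteq> ?p" if "a \<in> Poly_Mapping.keys f'" for a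
    using that f0 keys_le_lead[of a f]
    by (auto simp: in_keys_iff f'_def lookup_minus lookup_single when_def split: if_splits)
  have a0: "Poly_Mapping.lookup (f' * g) (?p @ ?q) = 0"
  proof (rule ccontr)
    assume "\<not> ?thesis"
    then have "?p @ ?q \<in> Poly_Mapping.keys (f' * g)" by (simp add: in_keys_iff)
    then obtain a b where "?p @ ?q = a + b" "a \<in> Poly_Mapping.keys f'" "b \<in> Poly_Mapping.keys g"
      using keys_mult[of f' g] by auto
    then show False
      using deglex_append_mono(2)[of a ?p b ?q] f1[of a] keys_le_lead[of b g]
      by (simp add: plus_list_def)
  qed
  define g' where "g' = g - Poly_Mapping.single ?q 1"
  have g: "g = Poly_Mapping.single ?q 1 + g'" by (simp add: g'_def)
  have g0: "Poly_Mapping.lookup g' ?q = 0"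
    using assms(2) by (simp add: g'_def lookup_minus monic_def)
  have b0: "Poly_Mapping.lookup (Poly_Mapping.single ?p 1 * g') (?p @ ?q) = 0"
  proof (rule ccontr)
    assume "\<not> ?thesis"
    then have "?p @ ?q \<in> Poly_Mapping.keys (Poly_Mapping.single ?p 1 * g')" by (simp add: in_keys_iff)
    then obtain b where "?p @ ?q = ?p + b" "b \<in> Poly_Mapping.keys g'"
      using keys_mult[of "Poly_Mapping.single ?p 1" g'] by auto
    then show False using g0 by (simp add: plus_list_def in_keys_iff)
  qed
  have "f * g = Poly_Mapping.single ?p 1 * (Poly_Mapping.single ?q 1 + g') + f' * g"
    using f g by (metis distrib_right)
  also have "\<dots> = Poly_Mapping.single (?p @ ?q) 1 + Poly_Mapping.single ?p 1 * g' + f' * g"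
    by (simp add: distrib_left mult_single plus_list_def)
  finally show "Poly_Mapping.lookup (f * g) (?p @ ?q) = 1"
    using a0 b0 by (simp add: lookup_add)
qed

lemma monic_lie:
  fixes f g :: "('x::wellorder, 'k::comm_ring_1) free_alg"
  assumes "monic f" "monic g" "lex_less (lead g @ lead f) (lead f @ lead g)"
  shows "monic (lie f g) \<and> lead (lie f g) = lead f @ lead g"
proof (rule monicI)
  have less: "lead g @ lead f < lead f @ lead g"
    using assms(3) by (subst lex_less_iff_less[symmetric]) auto
  have fg: "monic (f * g)" "lead (f * g) = lead f @ lead g"
    and gf: "lead (g * f) = lead g @ lead f"
    using monic_mult assms by blast+
  have "lead f @ lead g \<notin> Poly_Mapping.keys (g * f)"
    using keys_le_lead[of "lead f @ lead g" "g * f"] less gf by auto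
  then show "Poly_Mapping.lookup (lie f g) (lead f @ lead g) = 1"
    using fg by (simp add: lie_def lookup_minus monic_def in_keys_iff)
  fix v assume "v \<in> Poly_Mapping.keys (lie f g)"
  then have "v \<in> Poly_Mapping.keys (f * g) \<or> v \<in> Poly_Mapping.keys (g * f)"
    by (auto simp: lie_def in_keys_iff lookup_minus)
  then show "v \<le> lead f @ lead g"
    using keys_le_lead[of v] fg gf less by fastforce
qed

lemma monic_lie_eval:
  assumes "descending lead t" "\<And>f. f \<in> set (fringe t) \<Longrightarrow> monic f"
  shows "monic (lie_eval t) \<and> lead (lie_eval t) = tree_word lead t"
  using assms by (induction t) (auto intro!: monic_lie simp: monic_lie)

lemma lie_eval_mem_free_lie: "set (fringe t) \<subseteq> free_lie \<Longrightarrow> lie_eval t \<in> free_lie"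
  by (induction t) (auto intro: free_lie.lie)

lemma lie_ideal_subset_free_lie:
  assumes "T \<subseteq> free_lie"
  shows "lie_ideal T \<subseteq> free_lie"
proof
  fix f assume "f \<in> lie_ideal T"
  then show "f \<in> free_lie" using assms by induction (auto intro: free_lie.intros)
qed

lemma lie_eval_mem_lie_ideal:
  assumes "set (fringe t) \<subseteq> free_lie" "set (fringe t) \<inter> T \<noteq> {}"
  shows "lie_eval t \<in> lie_ideal T"
  using assms
proof (induction t)
  case (Br s t)
  then consider "lie_eval s \<in> lie_ideal T" | "lie_eval t \<in> lie_ideal T" by auto
  then show ?case
    using Br.prems by cases (auto intro: lie_ideal.lie_left lie_ideal.lie_right lie_eval_mem_free_lie)
qed (auto intro: lie_ideal.gen)

lemma tree_word_lead_letters: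
  "tree_word lead (map_nword (letter :: _ \<Rightarrow> ('x::wellorder, 'k::comm_ring_1) free_alg) t) = fringe t"
  by (simp add: tree_word_map comp_def)

lemma descending_lead_letters:
  "descending lead (map_nword (letter :: _ \<Rightarrow> ('x::wellorder, 'k::comm_ring_1) free_alg) t) \<longleftrightarrow>
   descending (\<lambda>x. [x]) t"
  by (simp add: descending_map comp_def)

lemma monic_nlsw_poly:
  assumes "alsw u"
  shows "monic (nlsw_poly u :: ('x::wellorder, 'k::comm_ring_1) free_alg)"
    and "lead (nlsw_poly u :: ('x, 'k) free_alg) = u"
proof -
  let ?t = "map_nword letter (nlsw u) :: ('x, 'k) free_alg nword"
  have "descending lead ?t" using descending_nlsw[OF assms] by (simp add: descending_lead_letters)
  moreover have "\<And>f. f \<in> set (fringe ?t) \<Longrightarrow> monic f" by (auto simp: fringe_map monic_letter)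
  ultimately have "monic (lie_eval ?t) \<and> lead (lie_eval ?t) = tree_word lead ?t"
    by (rule monic_lie_eval)
  then show "monic (nlsw_poly u :: ('x, 'k) free_alg)" "lead (nlsw_poly u :: ('x, 'k) free_alg) = u"
    using fringe_nlsw[OF alsw_not_Nil[OF assms]] by (simp_all add: nlsw_poly_def tree_word_lead_letters)
qed

lemma nlsw_poly_mem_free_lie: "nlsw_poly u \<in> free_lie"
  unfolding nlsw_poly_def by (rule lie_eval_mem_free_lie) (auto simp: fringe_map intro: free_lie.letter)

text \<open>In \<open>[asb]\<close> only sub-brackets with the same word have been exchanged, so the bracketing remains
  descending and the leading word can be read off from the leaves.\<close>

lemma special_poly_properties:
  fixes s :: "('x::wellorder, 'k::comm_ring_1) free_alg"
  assumes h: "special_poly a s b h" and s: "monic s"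
  obtains t where "fringe t = map letter a @ [s] @ map letter b" "h = lie_eval t" "monic h"
    "lead h = a @ lead s @ b"
proof -
  let ?v = "lead s"
  obtain t t' where t: "special_bracketing a ?v b t"
    and r: "replace_at (map_nword letter (nlsw ?v)) (Leaf s) (map letter a) (map letter b)
      (map_nword letter t) t'" and h_eq: "h = lie_eval t'"
    using h unfolding special_poly_def by blast
  obtain c d cs where avb: "alsw (a @ ?v @ b)" and v: "alsw ?v" and b: "b = c @ d"
    and vc: "alsw (?v @ c)" and c: "c = concat cs" and cs: "\<forall>e\<in>set cs. alsw e" "sorted_wrt lex_le cs"
    and rt: "replace_at (nlsw (?v @ c)) (foldl (\<lambda>r e. Br r (nlsw e)) (nlsw ?v) cs) a d
      (nlsw (a @ ?v @ b)) t"
    using t unfolding special_bracketing_def by blast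
  have fold: "descending (\<lambda>x. [x]) (foldl (\<lambda>r e. Br r (nlsw e)) (nlsw ?v) es) \<and>
      fringe (foldl (\<lambda>r e. Br r (nlsw e)) (nlsw ?v) es) = ?v @ concat es"
    if "cs = es @ fs" for es fs
    using that
  proof (induction es arbitrary: fs rule: rev_induct)
    case Nil
    then show ?case using descending_nlsw[OF v] fringe_nlsw[OF alsw_not_Nil[OF v]] by simp
  next
    case (snoc e es)
    have e: "alsw e" using snoc.prems cs(1) by auto
    let ?w = "?v @ concat es @ e"
    \<comment> \<open>The last factor \<open>g\<close> of \<open>c\<close> is a proper suffix of \<open>vc\<close>, and \<open>e\<close> is at most \<open>g\<close>.\<close>
    have "lex_less e (?v @ c)"
    proof -
      obtain gs g where g: "e # fs = gs @ [g]" by (cases "e # fs" rule: rev_cases) auto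
      then have cs_eq: "cs = es @ gs @ [g]" using snoc.prems by simp
      have "alsw g" using cs(1) cs_eq by auto
      then have "lex_less g ((?v @ concat es @ concat gs) @ g)"
        using vc alsw_not_Nil[OF v] alsw_not_Nil[of g] unfolding c cs_eq
        by (intro alsw_suffix_less) auto
      moreover have "lex_le e g"
      proof (cases "gs = []")
        case True
        then show ?thesis using g by (simp add: lex_le_def)
      next
        case False
        then obtain gs' where "gs = e # gs'" using g by (cases gs) auto
        then show ?thesis using cs(2) cs_eq by (simp add: sorted_wrt_append)
      qed
      ultimately show ?thesis using lex_le_less_trans unfolding c cs_eq by fastforce
    qed
    moreover have vc_eq: "?v @ c = ?w @ concat fs" using c snoc.prems by simp
    ultimately have "lex_less e (?w @ concat fs)" by simp
    \<comment> \<open>\<open>e\<close> is not longer than \<open>?w\<close>, so \<open>?w\<close> alone decides the comparison.\<close>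
    then have "lex_less (e @ ?v @ concat es) ?w" by (rule lex_less_truncate) simp
    then show ?case
      using snoc.IH[of "e # fs"] snoc.prems descending_nlsw[OF e] fringe_nlsw[OF alsw_not_Nil[OF e]]
      by simp
  qed
  have "descending (\<lambda>x. [x]) t \<and> fringe t = a @ ?v @ b"
    using replace_at_descending[OF rt, of "\<lambda>x. [x]"] fold[of cs "[]"] descending_nlsw[OF avb]
      fringe_nlsw[OF alsw_not_Nil[OF avb]] fringe_nlsw[OF alsw_not_Nil[OF vc]] c
    by simp
  then have dt: "descending lead t' \<and> tree_word lead t' = a @ ?v @ b"
    using replace_at_descending[OF r, of lead] fringe_nlsw[OF alsw_not_Nil[OF v]]
    by (simp add: tree_word_lead_letters descending_lead_letters)
  have fr: "fringe t' = map letter a @ [s] @ map letter b"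
    using replace_at_fringe[OF r] by simp
  then have "\<And>f. f \<in> set (fringe t') \<Longrightarrow> monic f" using s by (auto simp: monic_letter)
  then have "monic (lie_eval t') \<and> lead (lie_eval t') = a @ ?v @ b"
    using monic_lie_eval[of t'] dt by simp
  then show thesis using that fr h_eq by blast
qed

text \<open>Any descending bracketing of the letters of \<open>a\<close>, the block \<open>s\<close> and the letters of \<open>b\<close> evaluates
  to a normal word.\<close>

lemma ex_normal_word:
  fixes s :: "('x::wellorder, 'k::comm_ring_1) free_alg"
  assumes s: "monic s" "alsw (lead s)" and asb: "alsw (a @ lead s @ b)"
  obtains h where "normal_word a s b h" "monic h"
proof -
  let ?fs = "map letter a @ [s] @ map letter b"
  have word: "concat (map lead ?fs) = a @ lead s @ b"
    by (simp add: comp_def)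
  have "\<And>f. f \<in> set ?fs \<Longrightarrow> alsw (lead f)" using s(2) by auto
  then obtain t where t: "fringe t = ?fs" "descending lead t"
    using ex_descending_bracketing[of ?fs lead] asb unfolding word by blast
  moreover have "\<And>f. f \<in> set (fringe t) \<Longrightarrow> monic f" using t s(1) by (auto simp: monic_letter)
  ultimately have "monic (lie_eval t) \<and> lead (lie_eval t) = a @ lead s @ b"
    using monic_lie_eval[of t] word by (simp add: tree_word_eq)
  then have m: "monic (lie_eval t)" "lead (lie_eval t) = a @ lead s @ b" by blast+
  then have "normal_word a s b (lie_eval t)"
    unfolding normal_word_def using t(1) asb m by (intro conjI exI[of _ t]) (simp_all add: monic_def)
  then show thesis using m(1) by (rule that)
qed

section \<open>Lyndon--Shirshov words span the free Lie algebra\<close>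

text \<open>The bound \<open>v\<close> on the words and the finite alphabet \<open>A\<close> make the rewriting of Lie products below
  terminate.\<close>

definition nlsw_polys_above :: "'x::wellorder set \<Rightarrow> nat \<Rightarrow> 'x list \<Rightarrow> ('x, 'k::comm_ring_1) free_alg set" where
  "nlsw_polys_above A n v =
     {nlsw_poly w | w. alsw w \<and> length w = n \<and> set w \<subseteq> A \<and> lex_less v w}"

lemma nlsw_polys_above_mono: "lex_less v w \<Longrightarrow> nlsw_polys_above A n w \<subseteq> nlsw_polys_above A n v"
  unfolding nlsw_polys_above_def using lex_less_trans by blast

lemma lie_above_if_ordered:
  fixes p q v :: "'x::wellorder list"
  assumes "alsw p" "alsw q" "lex_less v p" "lex_less v q"
    and "\<And>r s. {r, s} = {p, q} \<Longrightarrow> lex_less s r \<Longrightarrow>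
      lie (nlsw_poly r) (nlsw_poly s) \<in> fa.span (nlsw_polys_above A n s :: ('x, 'k::comm_ring_1) free_alg set)"
  shows "lie (nlsw_poly p) (nlsw_poly q) \<in> fa.span (nlsw_polys_above A n v :: ('x, 'k) free_alg set)"
proof -
  have mono: "f \<in> fa.span (nlsw_polys_above A n v)"
    if "f \<in> fa.span (nlsw_polys_above A n w)" "lex_less v w"
    for f :: "('x, 'k) free_alg" and w
    using that fa.span_mono[OF nlsw_polys_above_mono] by blast
  consider "lex_less q p" | "p = q" | "lex_less p q" using lex_less_linear by blast
  then show ?thesis
  proof cases
    case 1
    then show ?thesis using assms(4) assms(5)[of p q] mono by blast
  next
    case 2
    then show ?thesis by (simp add: fa.span_zero)
  next
    case 3
    then have "lie (nlsw_poly q) (nlsw_poly p) \<in> fa.span (nlsw_polys_above A n v :: ('x, 'k) free_alg set)"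
      using assms(3) assms(5)[of q p] mono by blast
    then show ?thesis by (subst lie_swap) (rule fa.span_scale)
  qed
qed

text \<open>If \<open>([u][v])\<close> is not itself \<open>[uv]\<close>, then \<open>u = pq\<close> with \<open>q > v\<close>, and the Jacobi identity leads to
  \<open>([p][v])\<close> and \<open>([q][v])\<close>, which are shorter, and to products in which both factors are larger than
  \<open>v\<close>.  So the smaller factor increases, and there are finitely many words of bounded length in
  the letters that occur.\<close>

lemma lie_nlsw_poly_mem_span:
  fixes u v :: "'x::wellorder list"
  assumes "finite A" "alsw u" "alsw v" "set u \<subseteq> A" "set v \<subseteq> A" "lex_less v u"
  shows "lie (nlsw_poly u) (nlsw_poly v) \<in>
    fa.span (nlsw_polys_above A (length u + length v) v :: ('x, 'k::comm_ring_1) free_alg set)"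
  using assms(2-6)
proof (induction "length u + length v" arbitrary: u v rule: less_induct)
  case (less u\<^sub>0 v\<^sub>0)
  define n where "n = length u\<^sub>0 + length v\<^sub>0"
  let ?above = "\<lambda>n v. nlsw_polys_above A n v :: ('x, 'k) free_alg set"
  define larger_words where
    "larger_words v = {w. set w \<subseteq> A \<and> length w \<le> n \<and> lex_less v w}" for v
  have shorter: "lie (nlsw_poly u) (nlsw_poly v) \<in> fa.span (?above (length u + length v) v)"
    if "length u + length v < n" "alsw u" "alsw v" "set u \<subseteq> A" "set v \<subseteq> A" "lex_less v u" for u v
    using less.hyps[of u v] that unfolding n_def by blast
  have fin: "finite (larger_words v)" for v
    unfolding larger_words_def by (rule finite_subset[OF _ finite_lists_length_le[OF \<open>finite A\<close>, of n]]) auto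
  have "lie (nlsw_poly u) (nlsw_poly v) \<in> fa.span (?above n v)"
    if "length u + length v = n" "alsw u" "alsw v" "set u \<subseteq> A" "set v \<subseteq> A" "lex_less v u" for u v
    using that
  proof (induction "card (larger_words v)" arbitrary: u v rule: less_induct)
    case (less v u)
    show ?case
    proof (cases "2 \<le> length u \<and> \<not> lex_le (drop (cut u) u) v")
      case False
      then have "nlsw (u @ v) = Br (nlsw u) (nlsw v)"
        using less.prems by (intro nlsw_append) auto
      then have "lie (nlsw_poly u) (nlsw_poly v) = (nlsw_poly (u @ v) :: ('x, 'k) free_alg)"
        by (simp add: nlsw_poly_def)
      moreover have "alsw (u @ v)" using less.prems by (intro alsw_append)
      moreover have "lex_less v (u @ v)"
        using less.prems \<open>alsw (u @ v)\<close> by (intro alsw_suffix_less) (auto dest: alsw_not_Nil)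
      ultimately have "lie (nlsw_poly u) (nlsw_poly v) \<in> ?above n v"
        using less.prems unfolding nlsw_polys_above_def
        by (intro CollectI exI[of _ "u @ v"]) simp
      then show ?thesis by (rule fa.span_base)
    next
      case True
      define p q where "p = take (cut u) u" and "q = drop (cut u) u"
      have len: "2 \<le> length u" using True by simp
      have u: "u = p @ q" by (simp add: p_def q_def)
      have lens: "0 < length p" "0 < length q"
        using cut_bounds[OF len] by (simp_all add: p_def q_def)
      have pq: "alsw p" "alsw q"
        using alsw_take_cut[OF less.prems(2) len] alsw_drop_cut[OF len] by (simp_all add: p_def q_def)
      have sets: "set p \<subseteq> A" "set q \<subseteq> A" using less.prems(4) u by auto
      have "nlsw u = Br (nlsw p) (nlsw q)" using nlsw_Br[OF len] by (simp add: p_def q_def)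
      then have u_poly: "nlsw_poly u = lie (nlsw_poly p) (nlsw_poly q :: ('x, 'k) free_alg)"
        by (simp add: nlsw_poly_def)
      have vq: "lex_less v q" using True by (simp add: lex_le_iff_not_less q_def)
      have vp: "lex_less v p"
        using less.prems(6) lex_less_append_self[of q p] lens u lex_less_trans by auto
      have larger: "lie (nlsw_poly r) (nlsw_poly s) \<in> fa.span (?above n v)"
        if "alsw r" "alsw s" "set r \<subseteq> A" "set s \<subseteq> A" "length r + length s = n"
          "lex_less v r" "lex_less v s" for r s
      proof (rule lie_above_if_ordered[OF that(1,2,6,7)])
        fix x y assume xy: "{x, y} = {r, s}" "lex_less y x"
        have y: "lex_less v y" "set y \<subseteq> A" "length y \<le> n" using xy(1) that by (auto simp: doubleton_eq_iff)
        have "larger_words y \<subseteq> larger_words v"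
          using lex_less_trans[OF y(1)] unfolding larger_words_def by blast
        moreover have "y \<in> larger_words v" "y \<notin> larger_words y" using y by (simp_all add: larger_words_def)
        ultimately have "larger_words y \<subset> larger_words v" by blast
        then have "card (larger_words y) < card (larger_words v)" by (rule psubset_card_mono[OF fin])
        then show "lie (nlsw_poly x) (nlsw_poly y) \<in> fa.span (?above n y)"
        proof -
          have "length x + length y = n" "alsw x" "alsw y" "set x \<subseteq> A" "set y \<subseteq> A"
            using xy(1) that(1-5) by (auto simp: doubleton_eq_iff)
          with less.hyps[of y x] xy(2) \<open>card _ < card _\<close> show ?thesis by blast
        qed
      qed
      have n: "length p + length q + length v = n" using less.prems(1) u by simp
      have short: "length p + length v < n" "length q + length v < n" using n lens by linarith+
      have 1: "lie (lie (nlsw_poly p) (nlsw_poly v)) (nlsw_poly q) \<in> fa.span (?above n v)"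
      proof (rule lie_mem_span)
        show "lie (nlsw_poly p) (nlsw_poly v) \<in> fa.span (?above (length p + length v) v)"
          using short less.prems pq sets vp by (intro shorter) simp_all
        show "nlsw_poly q \<in> fa.span {nlsw_poly q :: ('x, 'k) free_alg}"
          by (rule fa.span_base) simp
        fix a b assume "a \<in> ?above (length p + length v) v" "b \<in> {nlsw_poly q :: ('x, 'k) free_alg}"
        moreover from this(1) obtain w where "a = nlsw_poly w" "alsw w"
          "length w = length p + length v" "set w \<subseteq> A" "lex_less v w"
          unfolding nlsw_polys_above_def by blast
        ultimately show "lie a b \<in> fa.span (?above n v)"
          using larger[of w q] pq sets vq n by simp
      qed
      have 2: "lie (nlsw_poly p) (lie (nlsw_poly q) (nlsw_poly v)) \<in> fa.span (?above n v)"
      proof (rule lie_mem_span)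
        show "lie (nlsw_poly q) (nlsw_poly v) \<in> fa.span (?above (length q + length v) v)"
          using short less.prems pq sets vq by (intro shorter) simp_all
        show "nlsw_poly p \<in> fa.span {nlsw_poly p :: ('x, 'k) free_alg}"
          by (rule fa.span_base) simp
        fix a b assume "a \<in> {nlsw_poly p :: ('x, 'k) free_alg}" "b \<in> ?above (length q + length v) v"
        moreover from this(2) obtain w where "b = nlsw_poly w" "alsw w"
          "length w = length q + length v" "set w \<subseteq> A" "lex_less v w"
          unfolding nlsw_polys_above_def by blast
        ultimately show "lie a b \<in> fa.span (?above n v)"
          using larger[of p w] pq sets vp n by simp
      qed
      from fa.span_add[OF 1 2] show ?thesis by (simp only: u_poly flip: lie_jacobi)
    qed
  qed
  from this[of u\<^sub>0 v\<^sub>0] show ?case using less.prems unfolding n_def by simp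
qed

theorem free_lie_eq_span:
  "(free_lie :: ('x::wellorder, 'k::comm_ring_1) free_alg set) = fa.span {nlsw_poly u | u. alsw u}"
proof
  let ?B = "{nlsw_poly u | u. alsw u} :: ('x, 'k) free_alg set"
  show "fa.span ?B \<subseteq> free_lie"
    by (rule fa.span_minimal[OF _ subspace_free_lie]) (auto intro: nlsw_poly_mem_free_lie)
  show "free_lie \<subseteq> fa.span ?B"
  proof
    fix f :: "('x, 'k) free_alg" assume "f \<in> free_lie"
    then show "f \<in> fa.span ?B"
    proof induction
      case (letter x)
      have "letter x = (nlsw_poly [x] :: ('x, 'k) free_alg)" by (simp add: nlsw_poly_def nlsw_short)
      then show ?case using alsw_singleton[of x] by (intro fa.span_base) blast
    next
      case (lie f g)
      have ordered: "lie (nlsw_poly u) (nlsw_poly v) \<in> fa.span ?B"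
        if "alsw u" "alsw v" "lex_less v u" for u v
      proof -
        have sub: "nlsw_polys_above (set u \<union> set v) (length u + length v) v \<subseteq> ?B"
          unfolding nlsw_polys_above_def by blast
        have "lie (nlsw_poly u) (nlsw_poly v) \<in>
            fa.span (nlsw_polys_above (set u \<union> set v) (length u + length v) v :: ('x, 'k) free_alg set)"
          using that by (intro lie_nlsw_poly_mem_span) simp_all
        then show ?thesis by (rule subsetD[OF fa.span_mono[OF sub]])
      qed
      have "lie (nlsw_poly u) (nlsw_poly v) \<in> fa.span ?B" if "alsw u" "alsw v" for u v
      proof -
        consider "lex_less v u" | "u = v" | "lex_less u v" using lex_less_linear by blast
        then show ?thesis
        proof cases
          case 1
          then show ?thesis using ordered that by blast
        next
          case 2
          then show ?thesis by (simp add: fa.span_zero)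
        next
          case 3
          then have "lie (nlsw_poly v) (nlsw_poly u) \<in> fa.span ?B" using ordered that by blast
          then show ?thesis by (subst lie_swap) (rule fa.span_scale)
        qed
      qed
      then show ?case using lie.IH by (intro lie_mem_span[of f ?B g ?B]) blast+
    qed (simp_all add: fa.span_zero fa.span_add fa.span_scale)
  qed
qed

text \<open>The leading words are distinct, so nothing cancels at the largest of them.\<close>

lemma lead_of_combination:
  fixes R :: "('x::wellorder, 'k::comm_ring_1) free_alg set"
  assumes R: "finite R" "R \<noteq> {}" "inj_on lead R" and mon: "\<And>a. a \<in> R \<Longrightarrow> monic a"
    and r: "\<And>a. a \<in> R \<Longrightarrow> r a \<noteq> 0"
  shows "(\<Sum>a\<in>R. scale (r a) a) \<noteq> 0 \<and> lead (\<Sum>a\<in>R. scale (r a) a) \<in> lead ` R"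
proof -
  define f where "f = (\<Sum>a\<in>R. scale (r a) a)"
  define m where "m = Max (lead ` R)"
  have "m \<in> lead ` R" unfolding m_def using R by (intro Max_in) auto
  then obtain a where a: "a \<in> R" "m = lead a" by auto
  have le: "lead b \<le> m" if "b \<in> R" for b unfolding m_def using R(1) that by simp
  have zero: "Poly_Mapping.lookup b m = 0" if "b \<in> R - {a}" for b
  proof -
    have "lead b \<noteq> m" using that a R(3) by (auto simp: inj_on_def)
    then show ?thesis using that le[of b] keys_le_lead[of m b] by (force simp: in_keys_iff)
  qed
  have "Poly_Mapping.lookup f m = (\<Sum>b\<in>R. r b * Poly_Mapping.lookup b m)"
    by (simp add: f_def lookup_sum)
  also have "\<dots> = r a * Poly_Mapping.lookup a m + (\<Sum>b\<in>R - {a}. r b * Poly_Mapping.lookup b m)"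
    using R(1) a(1) by (rule sum.remove)
  also have "\<dots> = r a" using zero mon[OF a(1)] a(2) by (simp add: monic_def)
  finally have m: "m \<in> Poly_Mapping.keys f" using r[OF a(1)] by (simp add: in_keys_iff)
  have "v \<le> m" if "v \<in> Poly_Mapping.keys f" for v
  proof (rule ccontr)
    assume *: "\<not> v \<le> m"
    have "Poly_Mapping.lookup b v = 0" if "b \<in> R" for b
      using * le[OF that] keys_le_lead[of v b] by (force simp: in_keys_iff)
    then have "Poly_Mapping.lookup f v = 0" by (simp add: f_def lookup_sum)
    then show False using that by (simp add: in_keys_iff)
  qed
  then have "lead f = m" using m by (intro lead_eqI)
  moreover have "f \<noteq> 0" using m by auto
  ultimately show ?thesis using a unfolding f_def by auto
qed

lemma inj_on_lead_nlsw_poly: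
  assumes "\<And>u. u \<in> B \<Longrightarrow> alsw u"
  shows "inj_on lead (nlsw_poly ` B :: ('x::wellorder, 'k::comm_ring_1) free_alg set)"
  using monic_nlsw_poly(2)[OF assms, where 'k = 'k] by (auto simp: inj_on_def)

lemma lead_mem_of_span:
  assumes B: "\<And>u. u \<in> B \<Longrightarrow> alsw u"
    and f: "f \<in> fa.span (nlsw_poly ` B)" "f \<noteq> (0 :: ('x::wellorder, 'k::comm_ring_1) free_alg)"
  shows "lead f \<in> B"
proof -
  obtain T r where T: "finite T" "T \<subseteq> nlsw_poly ` B" "(\<Sum>a\<in>T. scale (r a) a) = f"
    using f(1) unfolding fa.span_explicit by blast
  define R where "R = {a \<in> T. r a \<noteq> 0}"
  have "f = (\<Sum>a\<in>R. scale (r a) a)"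
    unfolding T(3)[symmetric] using T(1) by (intro sum.mono_neutral_right) (auto simp: R_def)
  moreover have "lead (\<Sum>a\<in>R. scale (r a) a) \<in> lead ` R"
  proof (rule conjunct2[OF lead_of_combination])
    show "finite R" using T(1) by (simp add: R_def)
    show "R \<noteq> {}" using \<open>f = _\<close> f(2) by auto
    show "inj_on lead R"
      by (rule inj_on_subset[OF inj_on_lead_nlsw_poly[OF B]]) (use T(2) in \<open>auto simp: R_def\<close>)
    show "monic a" if "a \<in> R" for a
      using that T(2) monic_nlsw_poly(1)[OF B, where 'k = 'k] by (auto simp: R_def)
    show "r a \<noteq> 0" if "a \<in> R" for a using that by (simp add: R_def)
  qed
  moreover have "lead ` R \<subseteq> B"
    using T(2) monic_nlsw_poly(2)[OF B, where 'k = 'k] by (auto simp: R_def)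
  ultimately show ?thesis by auto
qed

lemma alsw_lead:
  assumes "f \<in> free_lie" "f \<noteq> (0 :: ('x::wellorder, 'k::comm_ring_1) free_alg)"
  shows "alsw (lead f)"
proof -
  have "f \<in> fa.span (nlsw_poly ` Collect alsw)"
    using assms(1) unfolding free_lie_eq_span by (simp add: setcompr_eq_image)
  then show ?thesis using lead_mem_of_span[of "Collect alsw" f] assms(2) by simp
qed

section \<open>Words up to commutation\<close>

definition commuting :: "('x \<times> 'x) set \<Rightarrow> 'x \<Rightarrow> 'x \<Rightarrow> bool" where
  "commuting \<theta> a b \<longleftrightarrow> a \<noteq> b \<and> ((a, b) \<in> \<theta> \<or> (b, a) \<in> \<theta>)"

text \<open>Equality in the free partially commutative monoid, by its projections to the free monoids on
  pairs of letters that do not commute (and on single letters).\<close>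

definition trace_equiv :: "('x \<times> 'x) set \<Rightarrow> 'x list \<Rightarrow> 'x list \<Rightarrow> bool" where
  "trace_equiv \<theta> u v \<longleftrightarrow>
     (\<forall>a b. \<not> commuting \<theta> a b \<longrightarrow> filter (\<lambda>z. z = a \<or> z = b) u = filter (\<lambda>z. z = a \<or> z = b) v)"

lemma trace_equiv_refl [simp]: "trace_equiv \<theta> u u"
  by (simp add: trace_equiv_def)

lemma trace_equiv_swap:
  assumes "(a, b) \<in> \<theta>"
  shows "trace_equiv \<theta> w (p @ [a, b] @ q) \<longleftrightarrow> trace_equiv \<theta> w (p @ [b, a] @ q)"
proof -
  have "filter (\<lambda>z. z = c \<or> z = d) [a, b] = filter (\<lambda>z. z = c \<or> z = d) [b, a]"
    if "\<not> commuting \<theta> c d" for c d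
  proof -
    have "a = b" if "a = c \<or> a = d" "b = c \<or> b = d"
      using that \<open>\<not> commuting \<theta> c d\<close> assms by (auto simp: commuting_def)
    then show ?thesis by (cases "a = c \<or> a = d"; cases "b = c \<or> b = d") simp_all
  qed
  then show ?thesis unfolding trace_equiv_def filter_append by simp
qed

lemma trace_equiv_length:
  assumes "trace_equiv \<theta> u v"
  shows "length u = length v"
proof -
  have "mset u = mset v"
  proof (rule multiset_eqI)
    fix a
    have "\<not> commuting \<theta> a a" by (simp add: commuting_def)
    then have "filter (\<lambda>z. z = a \<or> z = a) u = filter (\<lambda>z. z = a \<or> z = a) v"
      using assms unfolding trace_equiv_def by blast
    then have "filter_mset (\<lambda>z. z = a) (mset u) = filter_mset (\<lambda>z. z = a) (mset v)"
      by (simp flip: mset_filter)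
    from arg_cong[OF this, of "\<lambda>M. count M a"] show "count (mset u) a = count (mset v) a" by simp
  qed
  then show ?thesis by (rule mset_eq_length)
qed

lemma less_same_length_split:
  fixes u v :: "'x::linorder list"
  assumes "v < u" "length u = length v"
  obtains p a b u' v' where "u = p @ a # u'" "v = p @ b # v'" "b < a"
proof -
  have "\<exists>p a b u' v'. u = p @ a # u' \<and> v = p @ b # v' \<and> b < a"
    using assms(2,1)
  proof (induction u v rule: list_induct2)
    case (Cons x u y v)
    show ?case
    proof (cases "y < x")
      case True
      then show ?thesis by (intro exI[of _ "[]"]) auto
    next
      case False
      then have "y = x" "v < u" using Cons.prems Cons.hyps by (auto simp: Cons_less_Cons)
      then obtain p a b u' v' where "u = p @ a # u'" "v = p @ b # v'" "b < a"
        using Cons.IH by blast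
      then have "x # u = (x # p) @ a # u' \<and> y # v = (x # p) @ b # v' \<and> b < a"
        using \<open>y = x\<close> by simp
      then show ?thesis by blast
    qed
  qed simp
  then show ?thesis using that by blast
qed

text \<open>Let \<open>v\<close> be smaller than \<open>u\<close>, with \<open>b < a\<close> at the first difference.  By the projections, the
  first \<open>b\<close> after that place in \<open>u\<close> is preceded, from there on, by letters that commute with \<open>b\<close>.
  The last of these that exceeds \<open>b\<close> is the beginning of a factor as required.\<close>

lemma trace_equiv_less_factor:
  fixes u v :: "'x::wellorder list"
  assumes eq: "trace_equiv \<theta> u v" and less: "v < u"
  shows "\<exists>p x w y q. u = p @ (x # w @ [y]) @ q \<and> tri \<theta> x y \<and> (\<forall>z\<in>set w. tri \<theta> y z)"
proof -
  obtain p a b u' v' where u: "u = p @ a # u'" and v: "v = p @ b # v'" and ba: "b < a"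
    using less_same_length_split[OF less trace_equiv_length[OF eq]] .
  have proj: "filter (\<lambda>z. z = b \<or> z = c) (a # u') = b # filter (\<lambda>z. z = b \<or> z = c) v'"
    if "\<not> commuting \<theta> b c" for c
  proof -
    have "filter (\<lambda>z. z = b \<or> z = c) u = filter (\<lambda>z. z = b \<or> z = c) v"
      using eq that unfolding trace_equiv_def by blast
    then have "filter (\<lambda>z. z = b \<or> z = c) (a # u') = filter (\<lambda>z. z = b \<or> z = c) (b # v')"
      unfolding u v filter_append same_append_eq .
    then show ?thesis by simp
  qed
  have "filter (\<lambda>z. z = b \<or> z = b) (a # u') = b # filter (\<lambda>z. z = b \<or> z = b) v'"
    by (rule proj) (simp add: commuting_def)
  then have "b \<in> set (filter (\<lambda>z. z = b \<or> z = b) (a # u'))"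
    by (simp only: list.set_intros)
  then have "b \<in> set (a # u')" by (rule subsetD[OF filter_is_subset])
  from split_list_first[OF this] obtain xs ys where xs: "a # u' = xs @ b # ys" "b \<notin> set xs"
    by blast
  have comm: "commuting \<theta> b c" if c: "c \<in> set xs" for c
  proof (rule ccontr)
    assume "\<not> ?thesis"
    from proj[OF this] have *: "filter (\<lambda>z. z = b \<or> z = c) (xs @ b # ys) = b # filter (\<lambda>z. z = b \<or> z = c) v'"
      unfolding xs(1) .
    have ne: "filter (\<lambda>z. z = b \<or> z = c) xs \<noteq> []" using c by (auto simp: filter_empty_conv)
    then have "hd (filter (\<lambda>z. z = b \<or> z = c) xs) = b"
      using arg_cong[OF *, of hd] by (simp add: hd_append)
    then show False using hd_in_set[OF ne] xs(2) by simp
  qed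
  have "a \<in> set xs" using xs ba by (cases xs) auto
  then have "\<exists>x\<in>set xs. b < x" using ba by blast
  then obtain xs1 x w where x: "xs = xs1 @ x # w" "b < x" "\<forall>z\<in>set w. \<not> b < z"
    by (rule split_list_last_propE)
  have "tri \<theta> x b" using comm[of x] x by (auto simp: tri_def commuting_def)
  moreover have "tri \<theta> b z" if "z \<in> set w" for z
  proof -
    have "z \<noteq> b" using that x(1) xs(2) by auto
    then show ?thesis using comm[of z] x that by (auto simp: tri_def commuting_def)
  qed
  moreover have "u = (p @ xs1) @ (x # w @ [b]) @ ys" using u xs(1) x(1) by simp
  ultimately show ?thesis by blast
qed

text \<open>The coefficient at the class of \<open>m\<close> of the image of \<open>f\<close> in the algebra of the free partially
  commutative monoid.\<close>

definition class_sum :: "('x \<times> 'x) set \<Rightarrow> 'x list \<Rightarrow> ('x, 'k::comm_ring_1) free_alg \<Rightarrow> 'k" where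
  "class_sum \<theta> m f =
     (\<Sum>v\<in>Poly_Mapping.keys f. if trace_equiv \<theta> m v then Poly_Mapping.lookup f v else 0)"

lemma class_sum_superset:
  assumes "finite V" "Poly_Mapping.keys f \<subseteq> V"
  shows "class_sum \<theta> m f = (\<Sum>v\<in>V. if trace_equiv \<theta> m v then Poly_Mapping.lookup f v else 0)"
  unfolding class_sum_def using assms by (intro sum.mono_neutral_left) (auto simp: in_keys_iff)

lemma class_sum_zero [simp]: "class_sum \<theta> m 0 = 0"
  by (simp add: class_sum_def)

lemma class_sum_add: "class_sum \<theta> m (f + g) = class_sum \<theta> m f + class_sum \<theta> m g"
proof -
  let ?V = "Poly_Mapping.keys f \<union> Poly_Mapping.keys g"
  have "Poly_Mapping.keys (f + g) \<subseteq> ?V" by (rule Poly_Mapping.keys_add)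
  then show ?thesis
    by (simp add: class_sum_superset[of ?V] lookup_add if_distrib cong: if_cong flip: sum.distrib)
qed

lemma class_sum_scale: "class_sum \<theta> m (scale c f) = c * class_sum \<theta> m f"
proof -
  have "Poly_Mapping.keys (scale c f) \<subseteq> Poly_Mapping.keys f" by (auto simp: in_keys_iff)
  then show ?thesis
    by (simp add: class_sum_superset[of "Poly_Mapping.keys f"] sum_distrib_left if_distrib cong: if_cong)
qed

lemma class_sum_diff: "class_sum \<theta> m (f - g) = class_sum \<theta> m f - class_sum \<theta> m g"
  using class_sum_add[of \<theta> m f "scale (- 1) g"] class_sum_scale[of \<theta> m "- 1" g] by simp

lemma class_sum_single:
  "class_sum \<theta> m (Poly_Mapping.single w c) = (if trace_equiv \<theta> m w then c else 0)"
  by (simp add: class_sum_superset[of "{w}"])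

text \<open>The class sums vanish on the two-sided associative ideal generated by the commutators, because
  \<open>p(ab - ba)q\<close> is a difference of equivalent words.\<close>

lemma class_sum_commutator:
  fixes g h :: "('x, 'k::comm_ring_1) free_alg"
  assumes "(a, b) \<in> \<theta>"
  shows "class_sum \<theta> m (g * lie (letter a) (letter b) * h) = 0"
proof (induction g rule: poly_mapping_plus_single_induct)
  case (plus_single g p c)
  have "class_sum \<theta> m (Poly_Mapping.single p c * lie (letter a) (letter b) * h) = 0"
  proof (induction h rule: poly_mapping_plus_single_induct)
    case (plus_single h q d)
    have "Poly_Mapping.single p c * lie (letter a) (letter b) * Poly_Mapping.single q d =
        Poly_Mapping.single (p @ [a, b] @ q) (c * d) - Poly_Mapping.single (p @ [b, a] @ q) (c * d)"
      by (simp add: lie_def letter_def mult_single plus_list_def algebra_simps)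
    then have "class_sum \<theta> m (Poly_Mapping.single p c * lie (letter a) (letter b) * Poly_Mapping.single q d) = 0"
      using trace_equiv_swap[OF assms] by (simp only: class_sum_diff class_sum_single) simp
    then show ?case using plus_single by (simp add: distrib_left class_sum_add)
  qed simp
  then show ?case using plus_single by (simp add: distrib_right class_sum_add)
qed simp

lemma class_sum_lie_ideal:
  fixes f :: "('x, 'k::comm_ring_1) free_alg"
  assumes "f \<in> lie_ideal (commutators \<theta>)"
  shows "class_sum \<theta> m f = 0"
proof -
  have "class_sum \<theta> m (g * f * h) = 0" for g h
    using assms
  proof (induction arbitrary: g h)
    case (gen f)
    then show ?case by (auto simp: commutators_def class_sum_commutator)
  next
    case (add f1 f2)
    then show ?case by (simp add: distrib_left distrib_right class_sum_add)
  next
    case (scale f c)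
    then show ?case by (simp add: scale_mult_left scale_mult_right class_sum_scale)
  next
    case (lie_left f1 f2)
    have "g * lie f1 f2 * h = (g * f1) * f2 * h - g * f2 * (f1 * h)"
      by (simp add: lie_def algebra_simps)
    then show ?case using lie_left.IH[of "g * f1" h] lie_left.IH[of g "f1 * h"] by (simp add: class_sum_diff)
  next
    case (lie_right f1 f2)
    have "g * lie f2 f1 * h = g * f2 * (f1 * h) - (g * f1) * f2 * h"
      by (simp add: lie_def algebra_simps)
    then show ?case using lie_right.IH[of "g * f1" h] lie_right.IH[of g "f1 * h"] by (simp add: class_sum_diff)
  qed simp
  from this[of 1 1] show ?thesis by simp
qed

section \<open>The defining relations\<close>

lemma alsw_Cons_max:
  assumes "\<And>z. z \<in> set w \<Longrightarrow> z < x"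
  shows "alsw (x # w)"
proof (rule alsw_if_suffixes_less)
  fix v s assume vs: "v \<noteq> []" "s \<noteq> []" "x # w = v @ s"
  then obtain z s' where "s = z # s'" "z \<in> set w" by (cases v; cases s) auto
  then show "lex_less s (x # w)" using assms by simp
qed simp

lemma alsw_relation_word:
  assumes "tri \<theta> x y" "\<forall>z\<in>set u. tri \<theta> y z"
  shows "alsw (x # u @ [y])"
  using assms by (intro alsw_Cons_max) (auto simp: tri_def intro: less_trans)

text \<open>All letters of \<open>u\<close> are smaller than \<open>y\<close>, and so is the longest proper ALSW suffix of \<open>xu\<close>.
  Hence \<open>y\<close> alone is split off.\<close>

lemma nlsw_relation_word:
  assumes "tri \<theta> x y" "\<forall>z\<in>set u. tri \<theta> y z"
  shows "nlsw (x # u @ [y]) = Br (nlsw (x # u)) (Leaf y)"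
proof -
  have "alsw (x # u)" using assms by (intro alsw_Cons_max) (auto simp: tri_def intro: less_trans)
  moreover have "lex_le (drop (cut (x # u)) (x # u)) [y]" if len: "2 \<le> length (x # u)"
  proof -
    note cut_bounds[OF len]
    then have "drop (cut (x # u)) (x # u) \<noteq> []" "set (drop (cut (x # u)) (x # u)) \<subseteq> set u"
      by (auto simp: drop_Cons' dest: in_set_dropD)
    then obtain z s where "drop (cut (x # u)) (x # u) = z # s" "z \<in> set u"
      by (cases "drop (cut (x # u)) (x # u)") auto
    then show ?thesis using assms(2) by (auto simp: lex_le_def tri_def)
  qed
  ultimately show ?thesis using nlsw_append[of "x # u" "[y]"] by (simp add: nlsw_short)
qed

lemma fpc_relations_properties:
  assumes "s \<in> (fpc_relations \<theta> :: ('x::wellorder, 'k::comm_ring_1) free_alg set)"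
  shows "s \<in> free_lie" "monic s" "alsw (lead s)"
proof -
  obtain x u y where s: "s = nlsw_poly (x # u @ [y])" "tri \<theta> x y" "\<forall>z\<in>set u. tri \<theta> y z"
    using assms unfolding fpc_relations_def by blast
  note a = alsw_relation_word[OF s(2,3)]
  show "s \<in> free_lie" unfolding s(1) by (rule nlsw_poly_mem_free_lie)
  show "monic s" unfolding s(1) by (rule monic_nlsw_poly(1)[OF a])
  show "alsw (lead s)" unfolding s(1) using monic_nlsw_poly(2)[OF a, where 'k = 'k] a by simp
qed

text \<open>An irreducible leading word is the smallest one of its class, so \<open>h\<close> would contain no other word
  of this class, and the class sum would be the leading coefficient.\<close>

lemma lead_reducible:
  fixes h :: "('x::wellorder, 'k::comm_ring_1) free_alg"
  assumes "h \<in> lie_ideal (commutators \<theta>)" "h \<noteq> 0"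
  shows "\<exists>s\<in>(fpc_relations \<theta> :: ('x, 'k) free_alg set). \<exists>a b. lead h = a @ lead s @ b"
proof -
  have "\<exists>v. trace_equiv \<theta> (lead h) v \<and> v < lead h"
  proof (rule ccontr)
    assume no: "\<not> ?thesis"
    have "v = lead h" if "v \<in> Poly_Mapping.keys h" "trace_equiv \<theta> (lead h) v" for v
      using no that keys_le_lead[of v h] by (auto simp: order.order_iff_strict)
    then have "class_sum \<theta> (lead h) h =
        (\<Sum>v\<in>Poly_Mapping.keys h. if v = lead h then Poly_Mapping.lookup h v else 0)"
      unfolding class_sum_def by (intro sum.cong) auto
    also have "\<dots> = Poly_Mapping.lookup h (lead h)"
      using lead_mem_keys[OF assms(2)] by simp
    finally show False
      using class_sum_lie_ideal[OF assms(1)] lead_mem_keys[OF assms(2)] by (simp add: in_keys_iff)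
  qed
  then obtain p x w y q where f: "lead h = p @ (x # w @ [y]) @ q" "tri \<theta> x y" "\<forall>z\<in>set w. tri \<theta> y z"
    using trace_equiv_less_factor by blast
  let ?s = "nlsw_poly (x # w @ [y]) :: ('x, 'k) free_alg"
  have "?s \<in> fpc_relations \<theta>" using f(2,3) unfolding fpc_relations_def by blast
  moreover have "lead ?s = x # w @ [y]" by (rule monic_nlsw_poly(2)[OF alsw_relation_word[OF f(2,3)]])
  ultimately show ?thesis using f(1) by metis
qed

lemma lie_ideal_mono:
  assumes "A \<subseteq> lie_ideal B"
  shows "lie_ideal A \<subseteq> lie_ideal B"
proof
  fix f assume "f \<in> lie_ideal A"
  then show "f \<in> lie_ideal B" using assms by induction (auto intro: lie_ideal.intros(2-))
qed

text \<open>\<open>f \<mapsto> (fg)\<close> is a derivation, so it maps a bracketing into the ideal as soon as it does so with the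
  leaves.\<close>

lemma lie_eval_commutes_mod_ideal:
  assumes "\<And>f. f \<in> set (fringe t) \<Longrightarrow> f \<in> free_lie \<and> lie f g \<in> lie_ideal T"
  shows "lie (lie_eval t) g \<in> lie_ideal T"
  using assms
proof (induction t)
  case (Br s t)
  have "lie_eval s \<in> free_lie" "lie_eval t \<in> free_lie"
    using Br.prems by (auto intro!: lie_eval_mem_free_lie)
  moreover have "lie (lie_eval s) g \<in> lie_ideal T" "lie (lie_eval t) g \<in> lie_ideal T"
    using Br by auto
  ultimately have "lie (lie (lie_eval s) g) (lie_eval t) + lie (lie_eval s) (lie (lie_eval t) g) \<in> lie_ideal T"
    by (meson lie_ideal.add lie_ideal.lie_left lie_ideal.lie_right)
  then show ?case by (simp flip: lie_jacobi)
qed simp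

text \<open>\<open>[xuy] = ([xu]y)\<close>, and \<open>y\<close> commutes with every letter of \<open>xu\<close>; conversely, the commutator of two
  letters is the relation with empty \<open>u\<close>, up to sign.\<close>

lemma lie_ideal_fpc_relations:
  "lie_ideal (fpc_relations \<theta>) = (lie_ideal (commutators \<theta>) :: ('x::wellorder, 'k::comm_ring_1) free_alg set)"
proof
  have comm: "lie (letter a) (letter b) \<in> (lie_ideal (commutators \<theta>) :: ('x, 'k) free_alg set)"
    if "(a, b) \<in> \<theta> \<or> (b, a) \<in> \<theta>" for a b
    using that
  proof
    assume "(a, b) \<in> \<theta>"
    then show ?thesis by (intro lie_ideal.gen) (auto simp: commutators_def)
  next
    assume "(b, a) \<in> \<theta>"
    then have "lie (letter b) (letter a) \<in> (lie_ideal (commutators \<theta>) :: ('x, 'k) free_alg set)"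
      by (intro lie_ideal.gen) (auto simp: commutators_def)
    then show ?thesis by (subst lie_swap) (rule lie_ideal.scale)
  qed
  show "lie_ideal (fpc_relations \<theta>) \<subseteq> (lie_ideal (commutators \<theta>) :: ('x, 'k) free_alg set)"
  proof (rule lie_ideal_mono, rule subsetI)
    fix s :: "('x, 'k) free_alg" assume "s \<in> fpc_relations \<theta>"
    then obtain x u y where s: "s = nlsw_poly (x # u @ [y])" "tri \<theta> x y" "\<forall>z\<in>set u. tri \<theta> y z"
      unfolding fpc_relations_def by blast
    have "s = lie (lie_eval (map_nword letter (nlsw (x # u)))) (letter y)"
      by (simp add: s(1) nlsw_poly_def nlsw_relation_word[OF s(2,3)])
    moreover have "f \<in> free_lie \<and> lie f (letter y) \<in> lie_ideal (commutators \<theta>)"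
      if "f \<in> set (fringe (map_nword letter (nlsw (x # u))))" for f :: "('x, 'k) free_alg"
    proof -
      obtain z where "f = letter z" "z = x \<or> z \<in> set u"
        using \<open>f \<in> set _\<close> fringe_nlsw[of "x # u"] by (auto simp: fringe_map)
      then show ?thesis using s(2,3) comm[of z y] by (auto simp: tri_def intro: free_lie.letter)
    qed
    ultimately show "s \<in> lie_ideal (commutators \<theta>)" using lie_eval_commutes_mod_ideal by metis
  qed
  have ordered: "lie (letter a) (letter b) \<in> (lie_ideal (fpc_relations \<theta>) :: ('x, 'k) free_alg set)"
    if "tri \<theta> a b" for a b
  proof (rule lie_ideal.gen)
    have "lie (letter a) (letter b) = (nlsw_poly (a # [] @ [b]) :: ('x, 'k) free_alg)"
      using nlsw_relation_word[of \<theta> a b "[]"] that by (simp add: nlsw_poly_def nlsw_short)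
    then show "lie (letter a) (letter b) \<in> (fpc_relations \<theta> :: ('x, 'k) free_alg set)"
      using that unfolding fpc_relations_def by fastforce
  qed
  show "(lie_ideal (commutators \<theta>) :: ('x, 'k) free_alg set) \<subseteq> lie_ideal (fpc_relations \<theta>)"
  proof (rule lie_ideal_mono, rule subsetI)
    fix f :: "('x, 'k) free_alg" assume "f \<in> commutators \<theta>"
    then obtain a b where f: "f = lie (letter a) (letter b)" "(a, b) \<in> \<theta>"
      unfolding commutators_def by blast
    consider "tri \<theta> a b" | "a = b" | "tri \<theta> b a"
      using f(2) linorder_less_linear[of a b] by (auto simp: tri_def)
    then show "f \<in> lie_ideal (fpc_relations \<theta>)"
    proof cases
      case 1
      then show ?thesis unfolding f(1) by (rule ordered)
    next
      case 2
      then show ?thesis unfolding f(1) by (simp add: lie_ideal.zero)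
    next
      case 3
      from lie_ideal.scale[OF ordered[OF this]] show ?thesis unfolding f(1) by (subst lie_swap)
    qed
  qed
qed

section \<open>Reduction by normal words\<close>

definition normal_words_below ::
  "('x::wellorder, 'k::comm_ring_1) free_alg set \<Rightarrow> 'x list \<Rightarrow> ('x, 'k) free_alg set" where
  "normal_words_below S w = {q. \<exists>a s b. s \<in> S \<and> normal_word a s b q \<and> a @ lead s @ b < w}"

lemma irr_eq: "irr S = nlsw_poly ` {u. alsw u \<and> (\<forall>s\<in>S. \<forall>a b. u \<noteq> a @ lead s @ b)}"
  unfolding irr_def by blast

lemma lead_diff_less:
  fixes f q :: "('x::wellorder, 'k::comm_ring_1) free_alg"
  assumes "monic q" "lead q = lead f"
  defines "g \<equiv> f - scale (Poly_Mapping.lookup f (lead f)) q"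
  shows "g = 0 \<or> lead g < lead f"
proof (cases "g = 0")
  case False
  let ?l = "lead g"
  have l: "Poly_Mapping.lookup g ?l \<noteq> 0" using lead_mem_keys[OF False] by (simp add: in_keys_iff)
  then have "?l \<in> Poly_Mapping.keys f \<or> ?l \<in> Poly_Mapping.keys q"
    by (auto simp: g_def lookup_minus in_keys_iff)
  then have "?l \<le> lead f" using keys_le_lead[of ?l f] keys_le_lead[of ?l q] assms(2) by auto
  moreover have "Poly_Mapping.lookup g (lead f) = 0"
    using assms(1,2) by (simp add: g_def lookup_minus monic_def)
  then have "?l \<noteq> lead f" using l by auto
  ultimately show ?thesis by (simp add: order.strict_iff_order)
qed simp

lemma normal_word_mem:
  assumes "normal_word a s b q" "s \<in> S" "S \<subseteq> free_lie"
  shows "q \<in> lie_ideal S" "q \<in> free_lie"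
proof -
  obtain t where t: "fringe t = map letter a @ [s] @ map letter b" "q = lie_eval t"
    using assms(1) unfolding normal_word_def by blast
  have "set (fringe t) \<subseteq> free_lie" using assms(2,3) t(1) by (auto intro: free_lie.letter)
  then show "q \<in> lie_ideal S" "q \<in> free_lie"
    unfolding t(2) using lie_eval_mem_lie_ideal[of t S] lie_eval_mem_free_lie[of t] assms(2) t(1) by auto
qed

text \<open>The leading term is removed by \<open>[u]\<close> if the leading word \<open>u\<close> is irreducible and by a normal word
  otherwise.  The remainder is again a Lie polynomial, so its leading word is an ALSW, and the process
  can go on.\<close>

lemma reduction:
  fixes f :: "('x::wellorder, 'k::comm_ring_1) free_alg"
  assumes S: "\<And>s. s \<in> S \<Longrightarrow> s \<in> free_lie \<and> monic s \<and> alsw (lead s)"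
    and f: "f \<in> free_lie" "f = 0 \<or> lead f < w"
  shows "f \<in> fa.span (irr S \<union> normal_words_below S w)"
  using f
proof (induction "lead f" arbitrary: f rule: less_induct)
  case less
  let ?V = "fa.span (irr S \<union> normal_words_below S w)"
  show ?case
  proof (cases "f = 0")
    case True
    then show ?thesis by (simp add: fa.span_zero)
  next
    case False
    then have lw: "lead f < w" using less.prems(2) by simp
    have a: "alsw (lead f)" using alsw_lead[OF less.prems(1) False] .
    obtain q where q: "q \<in> irr S \<union> normal_words_below S w" "q \<in> free_lie" "monic q" "lead q = lead f"
    proof (cases "\<exists>s\<in>S. \<exists>a b. lead f = a @ lead s @ b")
      case True
      then obtain s c d where s: "s \<in> S" "lead f = c @ lead s @ d" by blast
      then obtain q where q: "normal_word c s d q" "monic q"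
        using ex_normal_word[of s c d] S[OF s(1)] a by auto
      have "S \<subseteq> free_lie" using S by blast
      then have "q \<in> free_lie" using normal_word_mem(2) q(1) s(1) by blast
      moreover have "q \<in> normal_words_below S w"
        unfolding normal_words_below_def using q(1) s lw by auto
      moreover have "lead q = lead f" using q(1) s(2) unfolding normal_word_def by simp
      ultimately show thesis using q(2) that by blast
    next
      case False
      then have "nlsw_poly (lead f) \<in> irr S" unfolding irr_eq using a by blast
      then show thesis
        using that[of "nlsw_poly (lead f)"] monic_nlsw_poly[OF a] nlsw_poly_mem_free_lie[of "lead f"] by blast
    qed
    define c where "c = Poly_Mapping.lookup f (lead f)"
    define g where "g = f - scale c q"
    have g: "g = 0 \<or> lead g < lead f" unfolding g_def c_def using q(3,4) by (rule lead_diff_less)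
    have "g \<in> free_lie"
      unfolding g_def using less.prems(1) q(2)
      by (intro fa.subspace_diff[OF subspace_free_lie] free_lie.scale)
    have "g \<in> ?V"
      using g
    proof
      assume "lead g < lead f"
      then show ?thesis using less.hyps[of g] \<open>g \<in> free_lie\<close> less_trans[OF _ lw] by blast
    qed (simp add: fa.span_zero)
    moreover have "scale c q \<in> ?V" by (rule fa.span_scale[OF fa.span_base[OF q(1)]])
    ultimately have "g + scale c q \<in> ?V" by (rule fa.span_add)
    then show ?thesis by (simp add: g_def)
  qed
qed

lemma trivial_mod_if_span:
  assumes "h \<in> fa.span (normal_words_below S w)"
  shows "trivial_mod S w h"
proof -
  obtain T r where T: "finite T" "T \<subseteq> normal_words_below S w" "h = (\<Sum>q\<in>T. scale (r q) q)"
    using assms unfolding fa.span_explicit by blast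
  obtain e where e: "bij_betw e {0..<card T} T" using ex_bij_betw_nat_finite[OF T(1)] by blast
  have "\<forall>i. \<exists>a s b. i < card T \<longrightarrow> s \<in> S \<and> normal_word a s b (e i) \<and> a @ lead s @ b < w"
  proof
    fix i
    have "e i \<in> normal_words_below S w" if "i < card T"
      using that e T(2) by (auto simp: bij_betw_def)
    then show "\<exists>a s b. i < card T \<longrightarrow> s \<in> S \<and> normal_word a s b (e i) \<and> a @ lead s @ b < w"
      unfolding normal_words_below_def by blast
  qed
  then obtain a s b where asb: "\<forall>i. i < card T \<longrightarrow> s i \<in> S \<and> normal_word (a i) (s i) (b i) (e i) \<and>
      a i @ lead (s i) @ b i < w"
    by metis
  have h: "h = (\<Sum>i<card T. scale (r (e i)) (e i))"
    unfolding T(3) by (subst sum.reindex_bij_betw[OF e, symmetric]) (simp add: atLeast0LessThan)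
  show ?thesis
    unfolding trivial_mod_def
    by (rule exI[of _ "card T"], rule exI[of _ "\<lambda>i. r (e i)"], rule exI[of _ a],
      rule exI[of _ s], rule exI[of _ b], rule exI[of _ e]) (use asb h in simp)
qed

text \<open>A nonzero element of the span has an irreducible leading word, an element of the ideal a
  reducible one.\<close>

lemma span_irr_inter_ideal:
  fixes f :: "('x::wellorder, 'k::comm_ring_1) free_alg"
  assumes "f \<in> fa.span (irr (fpc_relations \<theta>))" "f \<in> lie_ideal (commutators \<theta>)"
  shows "f = 0"
proof (rule ccontr)
  assume f: "f \<noteq> 0"
  have "lead f \<in> {u. alsw u \<and> (\<forall>s\<in>(fpc_relations \<theta> :: ('x, 'k) free_alg set). \<forall>a b. u \<noteq> a @ lead s @ b)}"
    using lead_mem_of_span[OF _ assms(1)[unfolded irr_eq] f] by blast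
  then show False using lead_reducible[OF assms(2) f] by blast
qed

lemma lie_decomposition:
  fixes f :: "('x::wellorder, 'k::comm_ring_1) free_alg"
  assumes "f \<in> free_lie" "f = 0 \<or> lead f < w"
  obtains g r where "g \<in> fa.span (irr (fpc_relations \<theta>))"
    "r \<in> fa.span (normal_words_below (fpc_relations \<theta>) w)"
    "r \<in> lie_ideal (commutators \<theta>)" "f = g + r"
proof -
  let ?S = "fpc_relations \<theta> :: ('x, 'k) free_alg set"
  have S: "s \<in> free_lie \<and> monic s \<and> alsw (lead s)" if "s \<in> ?S" for s
    using fpc_relations_properties[OF that] by simp
  have "f \<in> fa.span (irr ?S \<union> normal_words_below ?S w)" by (rule reduction[OF S assms])
  then obtain g r where gr: "g \<in> fa.span (irr ?S)" "r \<in> fa.span (normal_words_below ?S w)" "f = g + r"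
    unfolding fa.span_Un by blast
  have "?S \<subseteq> free_lie" using S by blast
  then have "normal_words_below ?S w \<subseteq> lie_ideal ?S"
    unfolding normal_words_below_def using normal_word_mem(1) by blast
  then have "fa.span (normal_words_below ?S w) \<subseteq> lie_ideal ?S"
    by (rule fa.span_minimal[OF _ subspace_lie_ideal])
  then have "r \<in> lie_ideal (commutators \<theta>)" using gr(2) unfolding lie_ideal_fpc_relations by blast
  then show thesis using gr that by blast
qed

text \<open>The irreducible part of the reduction lies in the ideal as well, hence vanishes; what is left is a
  combination of normal words not above the leading word of \<open>h\<close>.\<close>

lemma ideal_trivial_mod:
  fixes h :: "('x::wellorder, 'k::comm_ring_1) free_alg"
  assumes "h \<in> lie_ideal (fpc_relations \<theta>)" "h = 0 \<or> lead h < w"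
  shows "trivial_mod (fpc_relations \<theta>) w h"
proof -
  let ?I = "lie_ideal (commutators \<theta>) :: ('x, 'k) free_alg set"
  have h: "h \<in> ?I" using assms(1) unfolding lie_ideal_fpc_relations .
  have "(fpc_relations \<theta> :: ('x, 'k) free_alg set) \<subseteq> free_lie"
    using fpc_relations_properties(1) by blast
  then have "h \<in> free_lie" using assms(1) lie_ideal_subset_free_lie by blast
  then obtain g r where gr: "g \<in> fa.span (irr (fpc_relations \<theta>))"
    "r \<in> fa.span (normal_words_below (fpc_relations \<theta>) w)" "r \<in> ?I" "h = g + r"
    using lie_decomposition[OF _ assms(2)] by blast
  have "h - r \<in> ?I" using h gr(3) by (rule fa.subspace_diff[OF subspace_lie_ideal])
  then have "g \<in> ?I" using gr(4) by simp
  then have "g = 0" using gr(1) span_irr_inter_ideal by blast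
  then show ?thesis using gr(2,4) by (intro trivial_mod_if_span) simp
qed

lemma special_poly_mem_lie_ideal:
  fixes s :: "('x::wellorder, 'k::comm_ring_1) free_alg"
  assumes "special_poly a s b h" "monic s" "s \<in> S" "s \<in> free_lie"
  shows "h \<in> lie_ideal S"
proof -
  obtain t where t: "fringe t = map letter a @ [s] @ map letter b" "h = lie_eval t"
    using special_poly_properties[OF assms(1,2)] by blast
  then have "set (fringe t) \<subseteq> free_lie" "set (fringe t) \<inter> S \<noteq> {}"
    using assms(3,4) by (auto intro: free_lie.letter)
  then show ?thesis unfolding t(2) by (rule lie_eval_mem_lie_ideal)
qed

lemma diff_monic:
  fixes p q :: "('x::wellorder, 'k::comm_ring_1) free_alg"
  assumes "monic p" "monic q" "lead p = w" "lead q = w"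
  shows "p - q = 0 \<or> lead (p - q) < w"
  using lead_diff_less[of q p] assms by (simp add: monic_def)

text \<open>Both terms of a composition are monic elements of the ideal with leading word \<open>w\<close>.  Therefore
  their difference has a smaller leading word, whatever the overlap looks like.\<close>

theorem fpc_relations_groebner_shirshov:
  "groebner_shirshov_basis (fpc_relations \<theta> :: ('x::wellorder, 'k::comm_ring_1) free_alg set)"
proof -
  let ?S = "fpc_relations \<theta> :: ('x, 'k) free_alg set"
  note S = fpc_relations_properties[of _ \<theta>]
  have special: "monic p \<and> lead p = a @ lead s @ b \<and> p \<in> lie_ideal ?S"
    if "s \<in> ?S" "special_poly a s b p" for a b s p
    using special_poly_properties[OF that(2) S(2)[OF that(1)]]
      special_poly_mem_lie_ideal[OF that(2) S(2)[OF that(1)] that(1) S(1)[OF that(1)]] by metis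
  have triv: "trivial_mod ?S w (p - q)"
    if "monic p \<and> lead p = w \<and> p \<in> lie_ideal ?S" "monic q \<and> lead q = w \<and> q \<in> lie_ideal ?S" for p q w
    using that by (intro ideal_trivial_mod diff_monic fa.subspace_diff[OF subspace_lie_ideal]) auto
  have "trivial_mod ?S w h" if f: "f \<in> ?S" and g: "g \<in> ?S"
    and c: "inclusion_composition f g w h \<or> intersection_composition f g w h" for f g w h
    using c
  proof
    assume "inclusion_composition f g w h"
    then obtain a b q where "w = lead f" "w = a @ lead g @ b" "special_poly a g b q" "h = f - q"
      unfolding inclusion_composition_def by blast
    then show ?thesis
      using triv[of f w q] special[OF g, of a b q] S(2)[OF f] lie_ideal.gen[OF f] by simp
  next
    assume "intersection_composition f g w h"
    then obtain a b p q where "w = lead f @ b" "w = a @ lead g" "special_poly [] f b p"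
      "special_poly a g [] q" "h = p - q"
      unfolding intersection_composition_def by blast
    then show ?thesis
      using triv[of p w q] special[OF f, of "[]" b p] special[OF g, of a "[]" q] by simp
  qed
  then show ?thesis
    unfolding groebner_shirshov_basis_def using S by blast
qed

section \<open>The presented Lie algebra\<close>

lemma residue_eq_iff:
  assumes "fa.subspace I"
  shows "residue I f = residue I g \<longleftrightarrow> f - g \<in> I"
proof
  assume "residue I f = residue I g"
  moreover have "f \<in> residue I f" using fa.subspace_0[OF assms] by (force simp: residue_def)
  ultimately obtain h where "h \<in> I" "f = g + h" by (auto simp: residue_def)
  then show "f - g \<in> I" by simp
next
  assume d: "f - g \<in> I"
  have sub: "residue I f' \<subseteq> residue I g'" if "f' - g' \<in> I" for f' g'
  proof
    fix x assume "x \<in> residue I f'"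
    then obtain h where "h \<in> I" "x = f' + h" by (auto simp: residue_def)
    then have "x = g' + ((f' - g') + h)" "(f' - g') + h \<in> I"
      using that fa.subspace_add[OF assms] by auto
    then show "x \<in> residue I g'" unfolding residue_def by blast
  qed
  moreover have "g - f \<in> I" using fa.subspace_neg[OF assms d] by simp
  ultimately show "residue I f = residue I g" using d by blast
qed

text \<open>The operations of the quotient are unions over all representatives, which therefore have to
  be seen to collapse.\<close>

lemma residue_UN:
  assumes "fa.subspace I" "\<And>f'. f' - f \<in> I \<Longrightarrow> F f' = F f"
  shows "(\<Union>f'\<in>residue I f. F f') = F f"
proof -
  have "f \<in> residue I f" using fa.subspace_0[OF assms(1)] by (force simp: residue_def)
  moreover have "F f' = F f" if "f' \<in> residue I f" for f'
    using that by (intro assms(2)) (auto simp: residue_def)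
  ultimately show ?thesis by blast
qed

lemma lie_pres_carrier: "carrier (lie_pres T) = residue (lie_ideal T) ` free_lie"
  and lie_pres_zero: "\<zero>\<^bsub>lie_pres T\<^esub> = residue (lie_ideal T) 0"
  by (simp_all add: lie_pres_def Let_def)

lemma lie_pres_add:
  "residue (lie_ideal T) f \<oplus>\<^bsub>lie_pres T\<^esub> residue (lie_ideal T) g = residue (lie_ideal T) (f + g)"
proof -
  let ?I = "lie_ideal T"
  have "residue ?I (f' + g') = residue ?I (f' + g)" if "g' - g \<in> ?I" for f' g'
    using that by (simp add: residue_eq_iff[OF subspace_lie_ideal])
  then have "(\<Union>g'\<in>residue ?I g. residue ?I (f' + g')) = residue ?I (f' + g)" for f'
    by (rule residue_UN[OF subspace_lie_ideal])
  moreover have "residue ?I (f' + g) = residue ?I (f + g)" if "f' - f \<in> ?I" for f'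
    using that by (simp add: residue_eq_iff[OF subspace_lie_ideal])
  then have "(\<Union>f'\<in>residue ?I f. residue ?I (f' + g)) = residue ?I (f + g)"
    by (rule residue_UN[OF subspace_lie_ideal])
  ultimately show ?thesis by (simp add: lie_pres_def Let_def)
qed

lemma lie_pres_smult:
  "c \<odot>\<^bsub>lie_pres T\<^esub> residue (lie_ideal T) f = residue (lie_ideal T) (scale c f)"
proof -
  let ?I = "lie_ideal T"
  have "residue ?I (scale c f') = residue ?I (scale c f)" if "f' - f \<in> ?I" for f'
    using lie_ideal.scale[OF that, of c]
    by (simp add: residue_eq_iff[OF subspace_lie_ideal] fa.scale_right_diff_distrib)
  then have "(\<Union>f'\<in>residue ?I f. residue ?I (scale c f')) = residue ?I (scale c f)"
    by (rule residue_UN[OF subspace_lie_ideal])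
  then show ?thesis by (simp add: lie_pres_def Let_def)
qed

lemma lie_pres_abelian_monoid: "abelian_monoid (lie_pres T)"
  by (rule abelian_monoidI)
    (auto simp: lie_pres_carrier lie_pres_zero lie_pres_add ac_simps intro: free_lie.zero free_lie.add)

lemma finsum_residue:
  assumes "finite A" "\<And>x. x \<in> A \<Longrightarrow> F x \<in> free_lie"
  shows "(\<Oplus>\<^bsub>lie_pres T\<^esub>x\<in>A. residue (lie_ideal T) (F x)) = residue (lie_ideal T) (\<Sum>x\<in>A. F x)"
proof -
  interpret abelian_monoid "lie_pres T" by (rule lie_pres_abelian_monoid)
  show ?thesis
    using assms
  proof (induction A)
    case empty
    then show ?case by (simp add: lie_pres_zero)
  next
    case (insert x A)
    then have "(\<lambda>x. residue (lie_ideal T) (F x)) \<in> A \<rightarrow> carrier (lie_pres T)"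
      "residue (lie_ideal T) (F x) \<in> carrier (lie_pres T)"
      by (auto simp: lie_pres_carrier)
    then show ?case using insert by (simp add: finsum_insert lie_pres_add)
  qed
qed

lemma finsum_smult_residue:
  assumes "finite A" "\<And>b. b \<in> A \<Longrightarrow> \<rho> b \<in> free_lie \<and> residue (lie_ideal T) (\<rho> b) = b"
  shows "(\<Oplus>\<^bsub>lie_pres T\<^esub>b\<in>A. c b \<odot>\<^bsub>lie_pres T\<^esub> b) = residue (lie_ideal T) (\<Sum>b\<in>A. scale (c b) (\<rho> b))"
proof -
  interpret abelian_monoid "lie_pres T" by (rule lie_pres_abelian_monoid)
  have mem: "scale (c b) (\<rho> b) \<in> free_lie" if "b \<in> A" for b
    using assms(2)[OF that] by (auto intro: free_lie.scale)
  have "(\<Oplus>\<^bsub>lie_pres T\<^esub>b\<in>A. c b \<odot>\<^bsub>lie_pres T\<^esub> b) =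
      (\<Oplus>\<^bsub>lie_pres T\<^esub>b\<in>A. residue (lie_ideal T) (scale (c b) (\<rho> b)))"
  proof (rule finsum_cong')
    show "(\<lambda>b. residue (lie_ideal T) (scale (c b) (\<rho> b))) \<in> A \<rightarrow> carrier (lie_pres T)"
      using mem by (auto simp: lie_pres_carrier)
    show "c b \<odot>\<^bsub>lie_pres T\<^esub> b = residue (lie_ideal T) (scale (c b) (\<rho> b))" if "b \<in> A" for b
      using lie_pres_smult[of T "c b" "\<rho> b"] assms(2)[OF that] by simp
  qed simp
  also have "\<dots> = residue (lie_ideal T) (\<Sum>b\<in>A. scale (c b) (\<rho> b))"
    using assms(1) mem by (rule finsum_residue)
  finally show ?thesis .
qed

text \<open>As residues of elements of \<open>B\<close> are distinct, each has a unique representative \<open>\<rho>\<close> in \<open>B\<close>, which turns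
  combinations of residues into residues of combinations.\<close>

lemma is_basis_lie_pres:
  fixes T :: "('x, 'k::comm_ring_1) free_alg set"
  assumes B: "B \<subseteq> free_lie" and inj: "inj_on (residue (lie_ideal T)) B"
    and indep: "\<And>R r. finite R \<Longrightarrow> R \<subseteq> B \<Longrightarrow> (\<Sum>b\<in>R. scale (r b) b) \<in> lie_ideal T \<Longrightarrow> \<forall>b\<in>R. r b = 0"
    and span: "\<And>f. f \<in> free_lie \<Longrightarrow> \<exists>g\<in>fa.span B. f - g \<in> lie_ideal T"
  shows "is_basis (lie_pres T) (residue (lie_ideal T) ` B)"
proof -
  let ?res = "residue (lie_ideal T)"
  define \<rho> where "\<rho> = inv_into B ?res"
  have \<rho>: "\<rho> b \<in> B" "?res (\<rho> b) = b" if "b \<in> ?res ` B" for b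
    using that by (simp_all add: \<rho>_def inv_into_into f_inv_into_f)
  have \<rho>_res: "\<rho> (?res b) = b" if "b \<in> B" for b using that inj by (simp add: \<rho>_def)
  have sum: "(\<Oplus>\<^bsub>lie_pres T\<^esub>b\<in>A. c b \<odot>\<^bsub>lie_pres T\<^esub> b) = ?res (\<Sum>b\<in>A. scale (c b) (\<rho> b))"
    if "finite A" "A \<subseteq> ?res ` B" for A c
  proof (rule finsum_smult_residue[OF that(1)])
    fix b assume "b \<in> A"
    then have "b \<in> ?res ` B" using that(2) by blast
    then show "\<rho> b \<in> free_lie \<and> ?res (\<rho> b) = b" using \<rho> B by blast
  qed
  show ?thesis
    unfolding is_basis_def
  proof (intro conjI allI impI ballI)
    show "?res ` B \<subseteq> carrier (lie_pres T)" using B by (auto simp: lie_pres_carrier)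
  next
    fix A c b
    assume A: "finite A" "A \<subseteq> ?res ` B" and b: "b \<in> A"
      and eq: "(\<Oplus>\<^bsub>lie_pres T\<^esub>b\<in>A. c b \<odot>\<^bsub>lie_pres T\<^esub> b) = \<zero>\<^bsub>lie_pres T\<^esub>"
    have inj_\<rho>: "inj_on \<rho> A" by (rule inj_on_inverseI[of _ ?res]) (use \<rho>(2) A(2) in auto)
    have "(\<Sum>b\<in>A. scale (c b) (\<rho> b)) \<in> lie_ideal T"
      using eq unfolding sum[OF A] lie_pres_zero by (simp add: residue_eq_iff[OF subspace_lie_ideal])
    moreover have "(\<Sum>b\<in>A. scale (c b) (\<rho> b)) = (\<Sum>b\<in>\<rho> ` A. scale (c (?res b)) b)"
      using \<rho>(2) A(2) by (subst sum.reindex[OF inj_\<rho>]) (auto intro!: sum.cong)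
    ultimately have "\<forall>b\<in>\<rho> ` A. c (?res b) = 0"
      using A \<rho>(1) by (intro indep) auto
    then have "c (?res (\<rho> b)) = 0" using b by blast
    then show "c b = 0" using \<rho>(2)[OF subsetD[OF A(2) b]] by simp
  next
    fix v assume "v \<in> carrier (lie_pres T)"
    then obtain f where f: "v = ?res f" "f \<in> free_lie" by (auto simp: lie_pres_carrier)
    obtain g where g: "g \<in> fa.span B" "f - g \<in> lie_ideal T" using span[OF f(2)] by blast
    obtain R r where R: "finite R" "R \<subseteq> B" "g = (\<Sum>b\<in>R. scale (r b) b)"
      using g(1) unfolding fa.span_explicit by blast
    have "inj_on ?res R" using inj R(2) by (rule inj_on_subset)
    then have "(\<Sum>b\<in>?res ` R. scale (r (\<rho> b)) (\<rho> b)) = g"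
      using \<rho>_res R(2) unfolding R(3) by (subst sum.reindex) (auto intro!: sum.cong)
    moreover have "?res ` R \<subseteq> ?res ` B" using R(2) by blast
    ultimately have "(\<Oplus>\<^bsub>lie_pres T\<^esub>b\<in>?res ` R. r (\<rho> b) \<odot>\<^bsub>lie_pres T\<^esub> b) = ?res g"
      using sum[of "?res ` R" "\<lambda>b. r (\<rho> b)"] R(1) by simp
    moreover have "v = ?res g" using f(1) g(2) by (simp add: residue_eq_iff[OF subspace_lie_ideal])
    ultimately have "finite (?res ` R) \<and> ?res ` R \<subseteq> ?res ` B \<and>
        v = (\<Oplus>\<^bsub>lie_pres T\<^esub>b\<in>?res ` R. r (\<rho> b) \<odot>\<^bsub>lie_pres T\<^esub> b)"
      using R(1) \<open>?res ` R \<subseteq> ?res ` B\<close> by simp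
    then show "\<exists>A c. finite A \<and> A \<subseteq> ?res ` B \<and> v = (\<Oplus>\<^bsub>lie_pres T\<^esub>b\<in>A. c b \<odot>\<^bsub>lie_pres T\<^esub> b)"
      by (intro exI[of _ "?res ` R"] exI[of _ "\<lambda>b. r (\<rho> b)"])
  qed
qed

theorem theorem3p3:
  fixes \<theta> :: "('x::wellorder \<times> 'x) set"
    and S :: "('x, 'k::comm_ring_1) free_alg set"
  assumes "\<theta> \<subseteq> UNIV \<times> UNIV - {(x, x) | x. x \<in> UNIV}"
    and "S = fpc_relations \<theta>"
  shows "groebner_shirshov_basis S \<and>
    lie_pres (commutators \<theta>) = lie_pres S \<and>
    inj_on (residue (lie_ideal (commutators \<theta>))) (irr S) \<and>
    is_basis (lie_pres (commutators \<theta>)) (residue (lie_ideal (commutators \<theta>)) ` irr S)"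
proof -
  let ?I = "lie_ideal (commutators \<theta>) :: ('x, 'k) free_alg set"
  have gsb: "groebner_shirshov_basis S"
    unfolding assms(2) by (rule fpc_relations_groebner_shirshov)
  have pres: "lie_pres (commutators \<theta>) = lie_pres S"
    unfolding lie_pres_def assms(2) lie_ideal_fpc_relations ..
  have zero: "f = 0" if "f \<in> fa.span (irr S)" "f \<in> ?I" for f
    using that span_irr_inter_ideal unfolding assms(2) by blast
  have inj: "inj_on (residue ?I) (irr S)"
  proof (rule inj_onI)
    fix f g assume fg: "f \<in> irr S" "g \<in> irr S" "residue ?I f = residue ?I g"
    have "f - g \<in> fa.span (irr S)" using fg(1,2) by (intro fa.span_diff fa.span_base)
    moreover have "f - g \<in> ?I" using fg(3) by (simp add: residue_eq_iff[OF subspace_lie_ideal])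
    ultimately show "f = g" using zero by fastforce
  qed
  have "is_basis (lie_pres (commutators \<theta>)) (residue ?I ` irr S)"
  proof (rule is_basis_lie_pres[OF _ inj])
    show "irr S \<subseteq> free_lie" unfolding irr_def by (auto intro: nlsw_poly_mem_free_lie)
  next
    fix R :: "('x, 'k) free_alg set" and r :: "('x, 'k) free_alg \<Rightarrow> 'k"
    assume R: "finite R" "R \<subseteq> irr S" "(\<Sum>b\<in>R. scale (r b) b) \<in> ?I"
    have "(\<Sum>b\<in>R. scale (r b) b) \<in> fa.span (irr S)"
      using R(2) by (intro fa.span_sum fa.span_scale fa.span_base) auto
    then have sum0: "(\<Sum>b\<in>R. scale (r b) b) = 0" using R(3) zero by blast
    define Q where "Q = {b \<in> R. r b \<noteq> 0}"
    have sumQ: "(\<Sum>b\<in>Q. scale (r b) b) = 0"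
      unfolding sum0[symmetric] using R(1) by (intro sum.mono_neutral_left) (auto simp: Q_def)
    have sub: "Q \<subseteq> nlsw_poly ` Collect alsw" using R(2) by (auto simp: Q_def irr_def)
    have "Q = {}"
    proof (rule ccontr)
      assume "Q \<noteq> {}"
      moreover have "finite Q" using R(1) by (simp add: Q_def)
      moreover have "inj_on lead Q"
        by (rule inj_on_subset[OF inj_on_lead_nlsw_poly sub]) simp
      moreover have "monic b" if "b \<in> Q" for b using that sub monic_nlsw_poly(1) by auto
      moreover have "r b \<noteq> 0" if "b \<in> Q" for b using that by (simp add: Q_def)
      ultimately show False using lead_of_combination[of Q r] sumQ by blast
    qed
    then show "\<forall>b\<in>R. r b = 0" by (auto simp: Q_def)
  next
    fix f :: "('x, 'k) free_alg" assume f: "f \<in> free_lie"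
    \<comment> \<open>Every longer word is an admissible bound for the reduction, so an arbitrary letter is prepended.\<close>
    have "lead f < undefined # lead f"
      by (simp add: list_less_def lenlex_conv)
    then obtain g r where "g \<in> fa.span (irr S)" "r \<in> ?I" "f = g + r"
      using lie_decomposition[OF f, of _ \<theta>] unfolding assms(2) by blast
    then show "\<exists>g\<in>fa.span (irr S). f - g \<in> ?I" by (intro bexI[of _ g]) simp_all
  qed
  with gsb pres inj show ?thesis by blast
qed

end
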